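(* Let $d\ge 1$, and let $X(\boldsymbol t)=-\int_0^\infty\int_{\mathbb R^d}\frac1{2\lambda}e^{-\lambda\|\boldsymbol t-\boldsymbol u\|}\Lambda(d\boldsymbol u,d\lambda)$, $\boldsymbol t\in\mathbb R^d$, be the supCAR random field with characteristic quadruple $(0,b,W,\pi)$ (see context). Then $X$ is well-defined in each of the following cases: (i) $b>0$, $$\int_0^\infty\frac{|\ln\lambda|^{d}}{\lambda^{d+2}}\,\pi(d\lambda)<\infty\quad\text{and}\quad\int_{1\le|x|<\infty}|x|(\ln|x|)^{d-1}\,W(dx)<\infty;$$ (ii) $b=0$, $$\int_0^\infty\frac{|\ln\lambda|^{d-1}}{\lambda^{d+1}}\,\pi(d\lambda)<\infty,\qquad \int_{1\le|x|<\infty}|x|(\ln|x|)^{d-1}\,W(dx)<\infty,$$ $$\int_0^{1/2}\frac{|\ln\lambda|^{d-1}}{\lambda^{d+2}}\int_{-2\lambda}^{2\lambda}x^2\,W(dx)\,\pi(d\lambda)<\infty,$$ and, for both $k=1$ and $k=2$, $$\int_0^{1/2}\frac{|\ln\lambda|^{d}}{\lambda^{d+2-k}}\int_{2\lambda\le|x|\le1}|x|^{2-k}\,W(dx)\,\pi(d\lambda)<\infty.$$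
   Context: Notation: $\|\cdot\|$ is the Euclidean norm, $\mathrm{Leb}$ is Lebesgue measure on $\mathbb R^d$, $\mathbb R^+=(0,\infty)$, and $C(s\ddagger\xi):=\log E e^{is\xi}$ is the cumulant function of a random variable $\xi$. Let $\tau(x)=x$ for $|x|\le1$ and $\tau(x)=\mathrm{sign}(x)$ for $|x|>1$. Let $b\ge0$, let $W$ be a Lévy measure on $\mathbb R$ (a Radon measure with $W(\{0\})=0$ and $\int_{\mathbb R}\min(1,x^2)W(dx)<\infty$), let $\pi$ be a probability measure on $\mathbb R^+$, and put $$\mathcal K(s)=-\frac b2s^2+\int_{\mathbb R}\left(e^{isx}-1-is\tau(x)\right)W(dx),\quad s\in\mathbb R.$$ Let $\mathcal S'$ be a ring of Borel subsets of $\mathbb R^+\times\mathbb R^d$ closed under countable intersections and containing an increasing sequence of sets whose union is the whole space; $\sigma(\mathcal S')$ is the generated $\sigma$-algebra. $\Lambda$ is an independently scattered infinitely divisible random measure on $\mathcal S'$: for disjoint $A_n\in\mathcal S'$ the variables $\Lambda(A_n)$ are independent, $\Lambda(\bigcup_nA_n)=\sum_n\Lambda(A_n)$ a.s. if $\bigcup_nA_n\in\mathcal S'$, and $C(s\ddagger\Lambda(A))=[\pi\times\mathrm{Leb}](A)\,\mathcal K(s)$ for $A\in\mathcal S'$ with $[\pi\times\mathrm{Leb}](A)<\infty$. Integrals with respect to $\Lambda$ are Rajput–Rosinski integrals: for a simple function $f=\sum_{i=1}^na_i\mathbb 1_{A_i}$ with disjoint $A_i\in\mathcal S'$, $\int_Af\,d\Lambda=\sum_ia_i\Lambda(A\cap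 A_i)$; a function $f$ is $\Lambda$-integrable if there are simple functions $f_n\to f$ almost everywhere (with respect to $\pi\times\mathrm{Leb}$) such that $\int_Af_n\,d\Lambda$ converges in probability for every $A\in\sigma(\mathcal S')$, and $\int_Af\,d\Lambda$ is then the limit in probability. "$X$ is well-defined" means that for each $\boldsymbol t\in\mathbb R^d$ the kernel $(\lambda,\boldsymbol u)\mapsto-\frac1{2\lambda}e^{-\lambda\|\boldsymbol t-\boldsymbol u\|}$ is $\Lambda$-integrable.
   Formalization: It is additionally assumed that the ring S' generates the Borel σ-algebra of ℝ⁺×ℝ^d; without this the claim fails, e.g. for S' consisting of the empty set and the whole space, where the kernel is not an a.e. limit of simple functions. *)

theory Defs
  imports "HOL-Probability.Probability"
begin

(* has_cumulant M X C says that C is the cumulant function s |-> log E exp(i s X).  The logarithm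
   is the distinguished one: the continuous branch along the characteristic function vanishing
   at 0, which is unique when it exists.  It is not the principal branch, since the imaginary
   part may leave the interval (-pi, pi]. *)
definition has_cumulant :: "'w measure \<Rightarrow> ('w \<Rightarrow> real) \<Rightarrow> (real \<Rightarrow> complex) \<Rightarrow> bool" where
  "has_cumulant M X C \<longleftrightarrow>
     continuous_on UNIV C \<and> C 0 = 0 \<and> (\<forall>s. char (distr M borel X) s = exp (C s))"

definition infinitely_divisible :: "real measure \<Rightarrow> bool" where
  "infinitely_divisible \<mu> \<longleftrightarrow>
     real_distribution \<mu> \<and>
     (\<forall>n>0. \<exists>\<nu>. real_distribution \<nu> \<and> ((convolution \<nu>) ^^ n) (return borel 0) = \<mu>)"

definition trunc :: "real \<Rightarrow> real" where
  "trunc x = (if \<bar>x\<bar> \<le> 1 then x else sgn x)"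

(* As usual for Levy measures, the Radon property is meant away from the origin (W may have
   infinite mass near 0); there it follows from the integrability condition. *)
definition levy_measure :: "real measure \<Rightarrow> bool" where
  "levy_measure W \<longleftrightarrow>
     sets W = sets borel \<and> emeasure W {0} = 0 \<and>
     (\<integral>\<^sup>+ x. ennreal (min 1 (x\<^sup>2)) \<partial>W) < \<infinity>"

definition levy_exponent :: "real \<Rightarrow> real measure \<Rightarrow> real \<Rightarrow> complex" where
  "levy_exponent b W s =
     - complex_of_real (b / 2 * s\<^sup>2) +
     (CLINT x|W. iexp (s * x) - 1 - \<i> * complex_of_real (s * trunc x))"

(* The measure m is the control measure (below: pi x Leb on (0,oo) x R^d).
   The sets in S may a priori have infinite m-measure; the cumulant function is prescribed only
   on those of finite m-measure.  The last assumption on S makes explicit that the Borel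
   functions to be integrated are measurable with respect to the sigma-algebra generated by S,
   without which they could not be limits of simple functions over S. *)
locale id_random_measure = prob_space M
  for M :: "'w measure" and m :: "'s measure" and \<K> :: "real \<Rightarrow> complex"
    and S :: "'s set set" and \<Lambda> :: "'s set \<Rightarrow> 'w \<Rightarrow> real" +
  assumes ring: "ring_of_sets (space m) S"
    and measurable_sets_S: "S \<subseteq> sets m"
    and countable_Inter: "\<And>A :: nat \<Rightarrow> 's set. range A \<subseteq> S \<Longrightarrow> (\<Inter>n. A n) \<in> S"
    and exhausting: "\<exists>A :: nat \<Rightarrow> 's set. range A \<subseteq> S \<and> incseq A \<and> (\<Union>n. A n) = space m"
    and generates: "sigma_sets (space m) S = sets m"
    and rv: "\<And>A. A \<in> S \<Longrightarrow> \<Lambda> A \<in> borel_measurable M"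
    and inf_div: "\<And>A. A \<in> S \<Longrightarrow> infinitely_divisible (distr M borel (\<Lambda> A))"
    and indep: "\<And>A :: nat \<Rightarrow> 's set. range A \<subseteq> S \<Longrightarrow> disjoint_family A \<Longrightarrow>
      indep_vars (\<lambda>_. borel) (\<lambda>n. \<Lambda> (A n)) UNIV"
    and sigma_additive: "\<And>A :: nat \<Rightarrow> 's set. range A \<subseteq> S \<Longrightarrow> disjoint_family A \<Longrightarrow>
      (\<Union>n. A n) \<in> S \<Longrightarrow> AE \<omega> in M. (\<lambda>n. \<Lambda> (A n) \<omega>) sums \<Lambda> (\<Union>n. A n) \<omega>"
    and cumulant: "\<And>A. A \<in> S \<Longrightarrow> emeasure m A < \<infinity> \<Longrightarrow>
      has_cumulant M (\<Lambda> A) (\<lambda>s. of_real (measure m A) * \<K> s)"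

(* The list [(a_1, A_1), ..., (a_n, A_n)] stands for the simple function
   a_1 1_{A_1} + ... + a_n 1_{A_n}. *)
type_synonym 's simple_rep = "(real \<times> 's set) list"

definition simple_rep :: "'s set set \<Rightarrow> 's simple_rep \<Rightarrow> bool" where
  "simple_rep S F \<longleftrightarrow>
     (\<forall>(a, A) \<in> set F. A \<in> S) \<and> sorted_wrt (\<lambda>(a, A) (a', A'). A \<inter> A' = {}) F"

definition simple_fun :: "'s simple_rep \<Rightarrow> 's \<Rightarrow> real" where
  "simple_fun F x = (\<Sum>(a, A) \<leftarrow> F. a * indicator A x)"

definition simple_integral ::
  "('s set \<Rightarrow> 'w \<Rightarrow> real) \<Rightarrow> 's set \<Rightarrow> 's simple_rep \<Rightarrow> 'w \<Rightarrow> real" where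
  "simple_integral \<Lambda> B F \<omega> = (\<Sum>(a, A) \<leftarrow> F. a * \<Lambda> (B \<inter> A) \<omega>)"

definition converges_in_prob ::
  "'w measure \<Rightarrow> (nat \<Rightarrow> 'w \<Rightarrow> real) \<Rightarrow> ('w \<Rightarrow> real) \<Rightarrow> bool" where
  "converges_in_prob M X Y \<longleftrightarrow>
     (\<forall>\<epsilon>>0. (\<lambda>n. measure M {\<omega> \<in> space M. \<bar>X n \<omega> - Y \<omega>\<bar> > \<epsilon>}) \<longlonglongrightarrow> 0)"

definition rr_integrable ::
  "'w measure \<Rightarrow> 's measure \<Rightarrow> 's set set \<Rightarrow> ('s set \<Rightarrow> 'w \<Rightarrow> real) \<Rightarrow> ('s \<Rightarrow> real) \<Rightarrow> bool" where
  "rr_integrable M m S \<Lambda> f \<longleftrightarrow>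
     (\<exists>F :: nat \<Rightarrow> 's simple_rep.
        (\<forall>n. simple_rep S (F n)) \<and>
        (AE x in m. (\<lambda>n. simple_fun (F n) x) \<longlonglongrightarrow> f x) \<and>
        (\<forall>B \<in> sigma_sets (space m) S. \<exists>Y \<in> borel_measurable M.
           converges_in_prob M (\<lambda>n. simple_integral \<Lambda> B (F n)) Y))"

definition supCAR_kernel :: "real ^ 'd \<Rightarrow> real \<times> (real ^ 'd) \<Rightarrow> real" where
  "supCAR_kernel t = (\<lambda>(l, u). - (1 / (2 * l)) * exp (- l * norm (t - u)))"

definition supCAR_well_defined ::
  "'w measure \<Rightarrow> real measure \<Rightarrow> (real \<times> (real ^ 'd)) set set \<Rightarrow>
   ((real \<times> (real ^ 'd)) set \<Rightarrow> 'w \<Rightarrow> real) \<Rightarrow> bool" where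
  "supCAR_well_defined M \<pi> S \<Lambda> \<longleftrightarrow>
     (\<forall>t. rr_integrable M (\<pi> \<Otimes>\<^sub>M lborel) S \<Lambda> (supCAR_kernel t))"

end

theory Submission
  imports Defs
begin

text \<open>
  Everything rests on one estimate.  For every cut-off \<open>r\<close> in \<open>(0, 1]\<close> the Levy exponent satisfies
  \<open>\<bar>\<K>(v)\<bar> \<le> \<alpha> v\<^sup>2 + \<beta> \<bar>v\<bar>\<close>, where, up to constant factors, \<open>\<alpha>\<close> collects the Gaussian variance and the second moment of the
  jumps of size at most \<open>r\<close>, and \<open>\<beta>\<close> the first moment of the larger ones
  (\<open>norm_levy_exponent_le\<close>).  The cut-off may be a function of the point \<open>(\<lambda>, u)\<close> at
  which the integrand is evaluated.

  Such a bound reduces integrability with respect to the random measure to an ordinary Lebesgue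
  integral: if \<open>\<integral> (\<alpha> f\<^sup>2 + \<beta> \<bar>f\<bar>) dm < \<infinity>\<close> then \<open>f\<close> is integrable
  (\<open>rr_integrable_if_growth_integrable\<close>).  Indeed, choose simple functions \<open>g\<^sub>n \<rightarrow> f\<close> with
  \<open>\<bar>g\<^sub>n\<bar> \<le> 2 \<bar>f\<bar>\<close>.  The integral of \<open>g\<^sub>n - g\<^sub>k\<close> over \<open>B\<close> has characteristic function
  \<open>exp (\<integral>\<^sub>B \<K>(s (g\<^sub>n - g\<^sub>k)) dm)\<close>; since \<open>\<alpha> v\<^sup>2 + \<beta> \<bar>v\<bar>\<close> is increasing in \<open>\<bar>v\<bar>\<close>,
  a property that \<open>\<bar>\<K>(v)\<bar>\<close> may lack, dominated convergence makes it tend to 1 as \<open>n, k \<rightarrow> \<infinity>\<close>.  By Levy's continuity theorem the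
  integrals form a Cauchy sequence in probability, and such sequences converge.

  For the supCAR kernel, \<open>\<integral> exp (-\<lambda> \<bar>t - u\<bar>) du\<close> is of order \<open>\<lambda>\<^sup>-\<^sup>d\<close>, so the criterion becomes the
  finiteness of \<open>\<integral> \<alpha>(\<lambda>) \<lambda>\<^sup>-\<^sup>d\<^sup>-\<^sup>2 \<pi>(d\<lambda>)\<close> and \<open>\<integral> \<beta>(\<lambda>) \<lambda>\<^sup>-\<^sup>d\<^sup>-\<^sup>1 \<pi>(d\<lambda>)\<close>
  (\<open>supCAR_well_defined_if_growth_integrable\<close>).  With a Gaussian part the constant cut-off 1 is good
  enough.  Without one, the cut-off \<open>min 1 (2 \<lambda>)\<close> balances the two terms: the kernel is at most
  \<open>1 / (2 \<lambda>)\<close>, so a jump \<open>x\<close> weighted by the kernel is at most 1 in size as long as \<open>\<bar>x\<bar> \<le> 2 \<lambda>\<close>.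
  The logarithms in the hypotheses are bounded below on \<open>(0, 1/2]\<close>, and every integrand in
  \<open>\<lambda>\<close> is bounded on the rest of the half-line.
\<close>

section \<open>Convergence in probability\<close>

text \<open>
  By Borel--Cantelli a subsequence along which the increments exceed \<open>2\<^sup>-\<^sup>j\<close> with probability less than
  \<open>2\<^sup>-\<^sup>j\<close> converges almost surely; the Cauchy property carries its limit over to the whole sequence.
\<close>

lemma (in prob_space) Cauchy_in_prob_imp_converges_in_prob:
  fixes X :: "nat \<Rightarrow> 'a \<Rightarrow> real"
  assumes [measurable]: "\<And>n. X n \<in> borel_measurable M"
    and Cauchy: "\<And>\<epsilon> \<delta>. \<epsilon> > 0 \<Longrightarrow> \<delta> > 0 \<Longrightarrow>
      \<exists>N. \<forall>n\<ge>N. \<forall>k\<ge>N. prob {\<omega> \<in> space M. \<bar>X n \<omega> - X k \<omega>\<bar> > \<epsilon>} < \<delta>"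
  shows "\<exists>Y \<in> borel_measurable M. converges_in_prob M X Y"
proof -
  have "\<forall>j. \<exists>N. \<forall>n\<ge>N. \<forall>k\<ge>N. prob {\<omega> \<in> space M. \<bar>X n \<omega> - X k \<omega>\<bar> > (1/2)^j} < (1/2::real)^j"
    by (intro allI Cauchy) auto
  from choice[OF this] obtain N where N: "\<forall>j. \<forall>n\<ge>N j. \<forall>k\<ge>N j.
      prob {\<omega> \<in> space M. \<bar>X n \<omega> - X k \<omega>\<bar> > (1/2)^j} < (1/2::real)^j" ..
  \<comment> \<open>The sum dominates every threshold up to \<open>j\<close>; the summand \<open>j\<close> makes \<open>r\<close> tend to infinity.\<close>
  define r where "r j = (\<Sum>i\<le>j. N i) + j" for j
  have N_le_r: "N j \<le> r i" if "j \<le> i" for i j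
    using member_le_sum[of j "{..i}" N] that by (auto simp: r_def)
  define D where "D j = {\<omega> \<in> space M. \<bar>X (r (Suc j)) \<omega> - X (r j) \<omega>\<bar> > (1/2)^j}" for j
  have [measurable]: "D j \<in> sets M" for j
    unfolding D_def by measurable
  have "prob (D j) \<le> (1/2)^j" for j
    unfolding D_def using N N_le_r[of j] by (intro less_imp_le) simp
  then have "summable (\<lambda>j. prob (D j))"
    by (intro summable_comparison_test'[OF summable_geometric[of "1/2::real"], of 0]) auto
  then have "AE \<omega> in M. \<forall>\<^sub>F j in sequentially. \<omega> \<in> space M - D j"
    by (intro borel_cantelli_AE1) (auto simp: emeasure_eq_measure)
  then have conv: "AE \<omega> in M. convergent (\<lambda>j. X (r j) \<omega>)"
  proof eventually_elim
    case (elim \<omega>)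
    have "\<forall>\<^sub>F j in sequentially. norm (X (r (Suc j)) \<omega> - X (r j) \<omega>) \<le> (1/2)^j"
      using elim by eventually_elim (auto simp: D_def)
    then have "summable (\<lambda>j. X (r (Suc j)) \<omega> - X (r j) \<omega>)"
      by (rule summable_comparison_test_ev) (auto intro: summable_geometric)
    then have "convergent (\<lambda>n. (\<Sum>j<n. X (r (Suc j)) \<omega> - X (r j) \<omega>) + X (r 0) \<omega>)"
      by (intro convergent_add convergent_const) (simp add: summable_iff_convergent)
    moreover have "(\<Sum>j<n. X (r (Suc j)) \<omega> - X (r j) \<omega>) + X (r 0) \<omega> = X (r n) \<omega>" for n
      using sum_lessThan_telescope[of "\<lambda>j. X (r j) \<omega>" n] by simp
    ultimately show ?case
      by simp
  qed
  define Y where "Y \<omega> = lim (\<lambda>j. X (r j) \<omega>)" for \<omega>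
  have [measurable]: "Y \<in> borel_measurable M"
    unfolding Y_def by measurable
  have sub: "(\<lambda>j. prob {\<omega> \<in> space M. \<bar>X (r j) \<omega> - Y \<omega>\<bar> > \<epsilon>}) \<longlonglongrightarrow> 0" if "\<epsilon> > 0" for \<epsilon>
  proof -
    have "(\<lambda>j. \<integral>\<omega>. indicator {\<omega> \<in> space M. \<bar>X (r j) \<omega> - Y \<omega>\<bar> > \<epsilon>} \<omega> \<partial>M) \<longlonglongrightarrow> (\<integral>\<omega>. (0::real) \<partial>M)"
    proof (rule integral_dominated_convergence[where w = "\<lambda>_. 1"])
      show "AE \<omega> in M. (\<lambda>j. indicator {\<omega> \<in> space M. \<bar>X (r j) \<omega> - Y \<omega>\<bar> > \<epsilon>} \<omega> :: real) \<longlonglongrightarrow> 0"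
        using conv
      proof eventually_elim
        case (elim \<omega>)
        then have "(\<lambda>j. X (r j) \<omega>) \<longlonglongrightarrow> Y \<omega>"
          by (simp add: Y_def convergent_LIMSEQ_iff)
        from tendstoD[OF this \<open>\<epsilon> > 0\<close>]
        have "\<forall>\<^sub>F j in sequentially. indicator {\<omega> \<in> space M. \<bar>X (r j) \<omega> - Y \<omega>\<bar> > \<epsilon>} \<omega> = (0::real)"
          by eventually_elim (auto simp: dist_real_def)
        then show ?case
          by (rule tendsto_eventually)
      qed
    qed (auto split: split_indicator)
    then show ?thesis by simp
  qed
  have "converges_in_prob M X Y"
    unfolding converges_in_prob_def
  proof (intro allI impI)
    fix \<epsilon> :: real assume "\<epsilon> > 0"
    show "(\<lambda>n. prob {\<omega> \<in> space M. \<bar>X n \<omega> - Y \<omega>\<bar> > \<epsilon>}) \<longlonglongrightarrow> 0"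
    proof (rule LIMSEQ_I)
      fix \<delta> :: real assume "\<delta> > 0"
      obtain K where K: "\<And>n k. K \<le> n \<Longrightarrow> K \<le> k \<Longrightarrow>
          prob {\<omega> \<in> space M. \<bar>X n \<omega> - X k \<omega>\<bar> > \<epsilon>/2} < \<delta>/2"
        using Cauchy[of "\<epsilon>/2" "\<delta>/2"] \<open>\<epsilon> > 0\<close> \<open>\<delta> > 0\<close> by auto
      have "\<forall>\<^sub>F j in sequentially. prob {\<omega> \<in> space M. \<bar>X (r j) \<omega> - Y \<omega>\<bar> > \<epsilon>/2} < \<delta>/2"
        using sub[of "\<epsilon>/2"] \<open>\<epsilon> > 0\<close> \<open>\<delta> > 0\<close> by (intro order_tendstoD) auto
      moreover have "\<forall>\<^sub>F j in sequentially. K \<le> r j"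
        by (intro eventually_sequentiallyI[of K]) (simp add: r_def)
      ultimately obtain j where j: "prob {\<omega> \<in> space M. \<bar>X (r j) \<omega> - Y \<omega>\<bar> > \<epsilon>/2} < \<delta>/2" "K \<le> r j"
        using eventually_happens'[OF _ eventually_conj] by (metis (no_types, lifting) sequentially_bot)
      have "norm (prob {\<omega> \<in> space M. \<bar>X n \<omega> - Y \<omega>\<bar> > \<epsilon>} - 0) < \<delta>" if "n \<ge> K" for n
      proof -
        have "prob {\<omega> \<in> space M. \<bar>X n \<omega> - Y \<omega>\<bar> > \<epsilon>} \<le>
            prob ({\<omega> \<in> space M. \<bar>X n \<omega> - X (r j) \<omega>\<bar> > \<epsilon>/2} \<union> {\<omega> \<in> space M. \<bar>X (r j) \<omega> - Y \<omega>\<bar> > \<epsilon>/2})"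
          by (intro finite_measure_mono) (auto, smt (verit) field_sum_of_halves)
        also have "\<dots> \<le> prob {\<omega> \<in> space M. \<bar>X n \<omega> - X (r j) \<omega>\<bar> > \<epsilon>/2} +
            prob {\<omega> \<in> space M. \<bar>X (r j) \<omega> - Y \<omega>\<bar> > \<epsilon>/2}"
          by (intro measure_subadditive) auto
        also have "\<dots> < \<delta>"
          using K[OF that j(2)] j(1) by simp
        finally show ?thesis by simp
      qed
      then show "\<exists>no. \<forall>n\<ge>no. norm (prob {\<omega> \<in> space M. \<bar>X n \<omega> - Y \<omega>\<bar> > \<epsilon>} - 0) < \<delta>"
        by blast
    qed
  qed
  then show ?thesis
    using \<open>Y \<in> borel_measurable M\<close> by (rule bexI)
qed

text \<open>
  The limit law in Levy's continuity theorem is the point mass at 0, for which \<open>{x. \<bar>x\<bar> > \<epsilon>}\<close> is a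
  continuity set of measure 0.
\<close>

lemma (in prob_space) char_tendsto_1_imp_in_prob_0:
  assumes rv: "\<And>n. X n \<in> borel_measurable M"
    and char: "\<And>s. (\<lambda>n. char (distr M borel (X n)) s) \<longlonglongrightarrow> 1"
    and "\<epsilon> > 0"
  shows "(\<lambda>n. prob {\<omega> \<in> space M. \<bar>X n \<omega>\<bar> > \<epsilon>}) \<longlonglongrightarrow> 0"
proof -
  note [measurable] = rv
  let ?A = "{x::real. \<bar>x\<bar> > \<epsilon>}"
  have dist: "real_distribution (distr M borel (X n))" for n
    by (rule real_distribution_distr) fact
  have dist0: "real_distribution (return borel (0::real))"
    by (auto simp: real_distribution_def real_distribution_axioms_def prob_space_return)
  have "weak_conv_m (\<lambda>n. distr M borel (X n)) (return borel 0)"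
    using dist dist0 char by (intro levy_continuity) (auto simp: char_def integral_return)
  moreover have "closure ?A \<subseteq> {x. \<bar>x\<bar> \<ge> \<epsilon>}"
    by (intro closure_minimal closed_Collect_le continuous_intros) auto
  then have "0 \<notin> frontier ?A"
    using \<open>\<epsilon> > 0\<close> by (auto simp: frontier_def)
  then have "emeasure (return borel 0) (frontier ?A) = 0"
    by (subst emeasure_return) auto
  ultimately have "(\<lambda>n. measure (distr M borel (X n)) ?A) \<longlonglongrightarrow> measure (return borel 0) ?A"
    using dist dist0 by (intro weak_conv_imp_continuity_set_conv) auto
  moreover have "measure (return borel 0) ?A = 0"
    using \<open>\<epsilon> > 0\<close> by (simp add: measure_return)
  moreover have "measure (distr M borel (X n)) ?A = prob {\<omega> \<in> space M. \<bar>X n \<omega>\<bar> > \<epsilon>}" for n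
    by (subst measure_distr) (auto intro!: arg_cong[where f = prob])
  ultimately show ?thesis by simp
qed

section \<open>Integrals of simple functions\<close>

context id_random_measure
begin

lemma empty_in_S: "{} \<in> S"
  using ring by (simp add: ring_of_sets_iff)

lemma Un_in_S: "A \<in> S \<Longrightarrow> B \<in> S \<Longrightarrow> A \<union> B \<in> S"
  using ring by (simp add: ring_of_sets_iff)

lemma Diff_in_S: "A \<in> S \<Longrightarrow> B \<in> S \<Longrightarrow> A - B \<in> S"
  using ring by (simp add: ring_of_sets_iff)

text \<open>
  The trace of \<open>S\<close> on one of its members is a \<open>\<sigma>\<close>-algebra, because complements
  in that member turn countable unions into countable intersections.  Hence \<open>B \<inter> A\<close>, on which the
  random measure has to be evaluated, belongs to its domain for every measurable \<open>B\<close>.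
\<close>

lemma Int_in_S:
  assumes "B \<in> sets m" "A \<in> S"
  shows "B \<inter> A \<in> S"
proof -
  have A: "A \<subseteq> space m"
    using assms(2) ring by (auto simp: ring_of_sets_iff)
  from assms(1) have "B \<in> sigma_sets (space m) S"
    by (simp add: generates)
  then show ?thesis
  proof induction
    case (Basic a)
    have "a \<inter> A = a - (a - A)" by auto
    then show ?case using Basic assms(2) by (metis Diff_in_S)
  next
    case (Compl a)
    have "(space m - a) \<inter> A = A - a \<inter> A" using A by auto
    then show ?case using Compl assms(2) by (metis Diff_in_S)
  next
    case (Union a)
    have "(\<Inter>i. A - a i \<inter> A) \<in> S"
      using Union assms(2) by (intro countable_Inter) (auto intro: Diff_in_S)
    then have "A - (\<Inter>i. A - a i \<inter> A) \<in> S"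
      using assms(2) by (intro Diff_in_S)
    also have "A - (\<Inter>i. A - a i \<inter> A) = (\<Union>i. a i) \<inter> A" by auto
    finally show ?case .
  qed (simp add: empty_in_S)
qed

lemma subset_in_S: "B \<in> sets m \<Longrightarrow> B \<subseteq> A \<Longrightarrow> A \<in> S \<Longrightarrow> B \<in> S"
  using Int_in_S[of B A] by (simp add: Int_absorb2)

text \<open>
  Countable additivity for a sequence of empty sets is a convergent series with constant terms,
  which must therefore vanish.
\<close>

lemma AE_Lambda_empty: "AE \<omega> in M. \<Lambda> {} \<omega> = 0"
proof -
  have "AE \<omega> in M. (\<lambda>n::nat. \<Lambda> {} \<omega>) sums \<Lambda> (\<Union>n::nat. {}) \<omega>"
    using empty_in_S by (intro sigma_additive) (auto simp: disjoint_family_on_def)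
  then show ?thesis
    by eventually_elim (auto dest!: sums_summable summable_LIMSEQ_zero simp: LIMSEQ_const_iff)
qed

text \<open>
  The axioms on the random measure speak of infinite sequences; padding with the empty set turns them
  into statements on finite families.
\<close>

lemma finite_disjoint_family_as_sequence:
  assumes "finite I" and S: "\<And>i. i \<in> I \<Longrightarrow> C i \<in> S" and disj: "disjoint_family_on C I"
  obtains h and A :: "nat \<Rightarrow> 's set"
  where "bij_betw h {0..<card I} I" "range A \<subseteq> S" "disjoint_family A"
    "\<forall>n<card I. A n = C (h n)" "\<forall>n\<ge>card I. A n = {}"
proof -
  obtain h where h: "bij_betw h {0..<card I} I"
    using ex_bij_betw_nat_finite[OF \<open>finite I\<close>] by auto
  define A where "A n = (if n < card I then C (h n) else {})" for n
  have hI: "h n \<in> I" if "n < card I" for n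
    using h that by (auto simp: bij_betw_def)
  have "disjoint_family A"
    unfolding disjoint_family_on_def
  proof safe
    fix i j x assume "i \<noteq> j" "x \<in> A i" "x \<in> A j"
    then have "i < card I" "j < card I" "x \<in> C (h i)" "x \<in> C (h j)"
      by (auto simp: A_def split: if_splits)
    moreover have "h i \<noteq> h j"
      using \<open>i \<noteq> j\<close> calculation(1,2) h by (auto simp: bij_betw_def inj_on_def)
    ultimately show "x \<in> {}"
      using disj hI by (auto simp: disjoint_family_on_def)
  qed
  moreover have "range A \<subseteq> S"
    using S hI empty_in_S by (auto simp: A_def)
  ultimately show ?thesis
    using h by (intro that[of h A]) (auto simp: A_def)
qed

lemma finite_additive:
  assumes "finite I" and S: "\<And>i. i \<in> I \<Longrightarrow> C i \<in> S" and disj: "disjoint_family_on C I"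
  shows "AE \<omega> in M. \<Lambda> (\<Union>i\<in>I. C i) \<omega> = (\<Sum>i\<in>I. \<Lambda> (C i) \<omega>)"
proof -
  obtain h A
    where h: "bij_betw h {0..<card I} I" and A: "range A \<subseteq> S" "disjoint_family A"
      "\<forall>n<card I. A n = C (h n)" "\<forall>n\<ge>card I. A n = {}"
    by (rule finite_disjoint_family_as_sequence[OF assms])
  have "(\<Union>n. A n) = (\<Union>n\<in>{0..<card I}. C (h n))"
  proof safe
    fix n x assume "x \<in> A n"
    then show "x \<in> (\<Union>n\<in>{0..<card I}. C (h n))"
      using A(3,4) by (cases "n < card I") auto
  qed (use A(3) in auto)
  also have "\<dots> = (\<Union>i\<in>h ` {0..<card I}. C i)"
    by (simp add: image_image)
  also have "h ` {0..<card I} = I"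
    using h by (simp add: bij_betw_def)
  finally have UA: "(\<Union>n. A n) = (\<Union>i\<in>I. C i)" .
  have "(\<Union>i\<in>I. C i) \<in> S"
    using \<open>finite I\<close> S by (induction I) (auto intro: empty_in_S Un_in_S)
  then have "AE \<omega> in M. (\<lambda>n. \<Lambda> (A n) \<omega>) sums \<Lambda> (\<Union>n. A n) \<omega>"
    using A by (intro sigma_additive) (auto simp: UA)
  with AE_Lambda_empty show ?thesis
  proof eventually_elim
    case (elim \<omega>)
    have "(\<lambda>n. \<Lambda> (A n) \<omega>) sums (\<Sum>n\<in>{0..<card I}. \<Lambda> (A n) \<omega>)"
      using elim(1) A(4) by (intro sums_finite) auto
    then have "\<Lambda> (\<Union>n. A n) \<omega> = (\<Sum>n\<in>{0..<card I}. \<Lambda> (A n) \<omega>)"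
      using elim(2) sums_unique2 by blast
    also have "\<dots> = (\<Sum>n\<in>{0..<card I}. \<Lambda> (C (h n)) \<omega>)"
      by (simp add: A(3))
    also have "\<dots> = (\<Sum>i\<in>I. \<Lambda> (C i) \<omega>)"
      by (rule sum.reindex_bij_betw[OF h])
    finally show ?case by (simp add: UA)
  qed
qed

lemma char_Lambda:
  assumes "A \<in> S" "emeasure m A < \<infinity>"
  shows "char (distr M borel (\<lambda>\<omega>. a * \<Lambda> A \<omega>)) s = exp (of_real (measure m A) * \<K> (s * a))"
proof -
  have [measurable]: "\<Lambda> A \<in> borel_measurable M" using rv assms by auto
  have "char (distr M borel (\<lambda>\<omega>. a * \<Lambda> A \<omega>)) s = char (distr M borel (\<Lambda> A)) (s * a)"
    by (simp add: char_def integral_distr mult.assoc)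
  then show ?thesis
    using cumulant[OF assms] by (simp add: has_cumulant_def)
qed

lemma char_linear_combination:
  assumes "finite I" and S: "\<And>i. i \<in> I \<Longrightarrow> C i \<in> S" and disj: "disjoint_family_on C I"
    and fin: "\<And>i. i \<in> I \<Longrightarrow> emeasure m (C i) < \<infinity>"
  shows "char (distr M borel (\<lambda>\<omega>. \<Sum>i\<in>I. a i * \<Lambda> (C i) \<omega>)) s =
    exp (\<Sum>i\<in>I. of_real (measure m (C i)) * \<K> (s * a i))"
proof -
  obtain h A
    where h: "bij_betw h {0..<card I} I" and A: "range A \<subseteq> S" "disjoint_family A"
      "\<forall>n<card I. A n = C (h n)" "\<forall>n\<ge>card I. A n = {}"
    by (rule finite_disjoint_family_as_sequence[OF assms(1-3)])
  have hI: "h n \<in> I" if "n < card I" for n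
    using h that by (auto simp: bij_betw_def)
  from A(1,2) have "indep_vars (\<lambda>_. borel) (\<lambda>n. \<Lambda> (A n)) {0..<card I}"
    by (intro indep_vars_subset[OF indep]) auto
  then have ind: "indep_vars (\<lambda>_. borel) (\<lambda>n \<omega>. a (h n) * \<Lambda> (A n) \<omega>) {0..<card I}"
    by (rule indep_vars_compose2) simp
  have "(\<lambda>\<omega>. \<Sum>i\<in>I. a i * \<Lambda> (C i) \<omega>) = (\<lambda>\<omega>. \<Sum>n\<in>{0..<card I}. a (h n) * \<Lambda> (A n) \<omega>)"
    by (intro ext, subst sum.reindex_bij_betw[OF h, symmetric]) (simp add: A(3))
  then have "char (distr M borel (\<lambda>\<omega>. \<Sum>i\<in>I. a i * \<Lambda> (C i) \<omega>)) s =
      (\<Prod>n\<in>{0..<card I}. char (distr M borel (\<lambda>\<omega>. a (h n) * \<Lambda> (A n) \<omega>)) s)"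
    using char_distr_sum[OF ind] by simp
  also have "\<dots> = (\<Prod>n\<in>{0..<card I}. exp (of_real (measure m (C (h n))) * \<K> (s * a (h n))))"
    using S fin hI by (intro prod.cong refl) (simp add: A(3) char_Lambda)
  also have "\<dots> = (\<Prod>i\<in>I. exp (of_real (measure m (C i)) * \<K> (s * a i)))"
    by (rule prod.reindex_bij_betw[OF h])
  finally show ?thesis
    by (simp add: exp_sum \<open>finite I\<close>)
qed

text \<open>
  The supporting set of finite measure matters: members of \<open>S\<close> may have infinite measure, and on those
  the cumulant function is not prescribed.
\<close>

definition elementary :: "('s \<Rightarrow> real) \<Rightarrow> bool" where
  "elementary g \<longleftrightarrow> simple_function m g \<and>
     (\<exists>D\<in>S. emeasure m D < \<infinity> \<and> (\<forall>x\<in>space m - D. g x = 0))"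

text \<open>
  The integral over \<open>B\<close> of a simple function, written in terms of the function instead of a list of
  values and cells, so that differences of simple functions can be integrated.  The value 0 is left
  out since its level set need not belong to \<open>S\<close>.
\<close>

definition step_integral :: "'s set \<Rightarrow> ('s \<Rightarrow> real) \<Rightarrow> 'w \<Rightarrow> real" where
  "step_integral B g \<omega> = (\<Sum>a\<in>g ` space m - {0}. a * \<Lambda> (B \<inter> (g -` {a} \<inter> space m)) \<omega>)"

lemma elementary_diff:
  assumes "elementary g" "elementary h"
  shows "elementary (\<lambda>x. g x - h x)"
proof -
  obtain D D' where D: "D \<in> S" "emeasure m D < \<infinity>" "\<And>x. x \<in> space m - D \<Longrightarrow> g x = 0"
    and D': "D' \<in> S" "emeasure m D' < \<infinity>" "\<And>x. x \<in> space m - D' \<Longrightarrow> h x = 0"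
    using assms unfolding elementary_def by blast
  have "D \<in> sets m" "D' \<in> sets m"
    using D(1) D'(1) measurable_sets_S by auto
  then have "emeasure m (D \<union> D') \<le> emeasure m D + emeasure m D'"
    by (rule emeasure_subadditive)
  also have "\<dots> < \<infinity>" using D(2) D'(2) by simp
  finally have "emeasure m (D \<union> D') < \<infinity>" .
  moreover have "D \<union> D' \<in> S" using D(1) D'(1) by (rule Un_in_S)
  moreover have "\<forall>x\<in>space m - (D \<union> D'). g x - h x = 0" using D(3) D'(3) by auto
  moreover have "simple_function m (\<lambda>x. g x - h x)"
    using assms by (intro simple_function_diff) (auto simp: elementary_def)
  ultimately show ?thesis unfolding elementary_def by blast
qed

lemma elementary_cell:
  assumes "elementary g" "C \<in> sets m" "\<And>x. x \<in> C \<Longrightarrow> g x \<noteq> 0"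
  shows "C \<in> S" "emeasure m C < \<infinity>"
proof -
  obtain D where D: "D \<in> S" "emeasure m D < \<infinity>" "\<And>x. x \<in> space m - D \<Longrightarrow> g x = 0"
    using assms(1) unfolding elementary_def by blast
  have sub: "C \<subseteq> D"
  proof
    fix x assume "x \<in> C"
    with sets.sets_into_space[OF assms(2)] have "x \<in> space m" by auto
    then show "x \<in> D" using D(3)[of x] assms(3)[OF \<open>x \<in> C\<close>] by auto
  qed
  then show "C \<in> S" using assms(2) D(1) by (metis subset_in_S)
  have "emeasure m C \<le> emeasure m D"
    using sub D(1) measurable_sets_S by (intro emeasure_mono) auto
  then show "emeasure m C < \<infinity>" using D(2) by simp
qed

lemma level_cell:
  assumes "elementary g" "B \<in> sets m" "a \<noteq> 0"
  shows "B \<inter> (g -` {a} \<inter> space m) \<in> S" "emeasure m (B \<inter> (g -` {a} \<inter> space m)) < \<infinity>"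
proof -
  have "B \<inter> (g -` {a} \<inter> space m) \<in> sets m"
    using assms(1,2) by (intro sets.Int simple_functionD) (auto simp: elementary_def)
  then show "B \<inter> (g -` {a} \<inter> space m) \<in> S" "emeasure m (B \<inter> (g -` {a} \<inter> space m)) < \<infinity>"
    using elementary_cell[OF assms(1)] assms(3) by auto
qed

lemma finite_range_elementary: "elementary g \<Longrightarrow> finite (g ` space m)"
  by (auto simp: elementary_def dest: simple_functionD)

lemma step_integral_measurable:
  assumes "elementary g" "B \<in> sets m"
  shows "step_integral B g \<in> borel_measurable M"
proof -
  have "step_integral B g = (\<lambda>\<omega>. \<Sum>a\<in>g ` space m - {0}. a * \<Lambda> (B \<inter> (g -` {a} \<inter> space m)) \<omega>)"
    by (simp add: step_integral_def fun_eq_iff)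
  also have "\<dots> \<in> borel_measurable M"
    using level_cell(1)[OF assms]
    by (intro borel_measurable_sum borel_measurable_times borel_measurable_const rv) auto
  finally show ?thesis .
qed

text \<open>
  The integral may be computed on any finite partition, given as the fibres of \<open>p\<close>, that is finer than
  the level sets.  The equation holds only almost surely because additivity does.
\<close>

lemma step_integral_refine:
  fixes p :: "'s \<Rightarrow> 'b" and k :: "'b \<Rightarrow> real"
  assumes g: "elementary g" and B: "B \<in> sets m"
    and fin: "finite (p ` space m)" and p: "\<And>t. p -` {t} \<inter> space m \<in> sets m"
    and gp: "\<And>x. x \<in> space m \<Longrightarrow> g x = k (p x)"
  shows "AE \<omega> in M. step_integral B g \<omega> =
    (\<Sum>t\<in>p ` space m. k t * \<Lambda> (B \<inter> (p -` {t} \<inter> space m)) \<omega>)"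
proof -
  define T where "T = {t \<in> p ` space m. k t \<noteq> 0}"
  define cell where "cell t = B \<inter> (p -` {t} \<inter> space m)" for t
  have cell: "cell t \<in> S" if "t \<in> T" for t
    unfolding cell_def using that gp p B
    by (intro elementary_cell[OF g]) (auto simp: T_def)
  have "finite T" using fin by (simp add: T_def)
  have level: "B \<inter> (g -` {a} \<inter> space m) = (\<Union>t\<in>{t\<in>T. k t = a}. cell t)" if "a \<noteq> 0" for a
    using that gp by (auto simp: cell_def T_def)
  have "AE \<omega> in M. \<Lambda> (\<Union>t\<in>{t\<in>T. k t = a}. cell t) \<omega> = (\<Sum>t\<in>{t\<in>T. k t = a}. \<Lambda> (cell t) \<omega>)" for a
    using \<open>finite T\<close> cell
    by (intro finite_additive) (auto simp: disjoint_family_on_def cell_def)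
  then have "AE \<omega> in M. \<forall>a\<in>g ` space m - {0}.
      \<Lambda> (\<Union>t\<in>{t\<in>T. k t = a}. cell t) \<omega> = (\<Sum>t\<in>{t\<in>T. k t = a}. \<Lambda> (cell t) \<omega>)"
    using finite_range_elementary[OF g] by (intro AE_finite_allI) auto
  then show ?thesis
  proof eventually_elim
    case (elim \<omega>)
    have "step_integral B g \<omega> =
        (\<Sum>a\<in>g ` space m - {0}. a * (\<Sum>t\<in>{t\<in>T. k t = a}. \<Lambda> (cell t) \<omega>))"
      unfolding step_integral_def using elim by (intro sum.cong refl) (auto simp: level)
    also have "\<dots> = (\<Sum>a\<in>g ` space m - {0}. \<Sum>t\<in>{t\<in>T. k t = a}. k t * \<Lambda> (cell t) \<omega>)"
      by (simp add: sum_distrib_left)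
    also have "\<dots> = (\<Sum>t\<in>T. k t * \<Lambda> (cell t) \<omega>)"
      using finite_range_elementary[OF g] \<open>finite T\<close> gp
      by (intro sum.group) (auto simp: T_def)
    also have "\<dots> = (\<Sum>t\<in>p ` space m. k t * \<Lambda> (cell t) \<omega>)"
      using fin by (intro sum.mono_neutral_left) (auto simp: T_def)
    finally show ?case by (simp add: cell_def)
  qed
qed

text \<open>
  Both functions are constant on the cells of their common refinement, the fibres of
  \<open>x \<mapsto> (g x, h x)\<close>.
\<close>

lemma step_integral_diff:
  assumes g: "elementary g" and h: "elementary h" and B: "B \<in> sets m"
  shows "AE \<omega> in M. step_integral B (\<lambda>x. g x - h x) \<omega> = step_integral B g \<omega> - step_integral B h \<omega>"
proof -
  define p where "p x = (g x, h x)" for x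
  have fin: "finite (p ` space m)"
  proof (rule finite_subset)
    show "p ` space m \<subseteq> g ` space m \<times> h ` space m" by (auto simp: p_def)
  qed (use g h in \<open>auto intro: finite_range_elementary\<close>)
  have "p -` {t} \<inter> space m \<in> sets m" for t
  proof -
    have "p -` {t} \<inter> space m = (g -` {fst t} \<inter> space m) \<inter> (h -` {snd t} \<inter> space m)"
      by (cases t) (auto simp: p_def)
    also have "\<dots> \<in> sets m"
      using g h by (intro sets.Int simple_functionD) (auto simp: elementary_def)
    finally show ?thesis .
  qed
  note refine = step_integral_refine[OF _ B fin this]
  have "AE \<omega> in M. step_integral B g \<omega> = (\<Sum>t\<in>p ` space m. fst t * \<Lambda> (B \<inter> (p -` {t} \<inter> space m)) \<omega>)"
    by (rule refine[OF g]) (simp add: p_def)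
  moreover have "AE \<omega> in M. step_integral B h \<omega> =
      (\<Sum>t\<in>p ` space m. snd t * \<Lambda> (B \<inter> (p -` {t} \<inter> space m)) \<omega>)"
    by (rule refine[OF h]) (simp add: p_def)
  moreover have "AE \<omega> in M. step_integral B (\<lambda>x. g x - h x) \<omega> =
      (\<Sum>t\<in>p ` space m. (fst t - snd t) * \<Lambda> (B \<inter> (p -` {t} \<inter> space m)) \<omega>)"
    by (rule refine[OF elementary_diff[OF g h]]) (simp add: p_def)
  ultimately show ?thesis
    by eventually_elim (simp add: left_diff_distrib sum_subtractf)
qed

lemma char_step_integral:
  assumes "elementary g" "B \<in> sets m"
  shows "char (distr M borel (step_integral B g)) s = exp (\<Sum>a\<in>g ` space m - {0}.
    of_real (measure m (B \<inter> (g -` {a} \<inter> space m))) * \<K> (s * a))"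
proof -
  have "step_integral B g = (\<lambda>\<omega>. \<Sum>a\<in>g ` space m - {0}. a * \<Lambda> (B \<inter> (g -` {a} \<inter> space m)) \<omega>)"
    by (simp add: step_integral_def fun_eq_iff)
  then show ?thesis
    using finite_range_elementary[OF assms(1)] level_cell[OF assms]
    by (simp only:) (intro char_linear_combination, auto simp: disjoint_family_on_def)
qed

subsection \<open>Integrability from a growth bound on the exponent\<close>

text \<open>
  The exponent of the characteristic function is \<open>\<integral>\<^sub>B \<K>(s g) dm\<close> with the level set at 0 left out; each
  point of the space contributes to at most one of its summands.
\<close>

lemma norm_step_exponent_le:
  assumes g: "elementary g" and B: "B \<in> sets m"
    and bound: "\<And>x v. x \<in> space m \<Longrightarrow> norm (\<K> v) \<le> \<alpha> x * v\<^sup>2 + \<beta> x * \<bar>v\<bar>"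
  shows "ennreal (norm (\<Sum>a\<in>g ` space m - {0}.
      of_real (measure m (B \<inter> (g -` {a} \<inter> space m))) * \<K> (s * a)))
    \<le> (\<integral>\<^sup>+x. ennreal (\<alpha> x * (s * g x)\<^sup>2 + \<beta> x * \<bar>s * g x\<bar>) \<partial>m)"
proof -
  define L where "L a = B \<inter> (g -` {a} \<inter> space m)" for a
  define R where "R = g ` space m - {0}"
  have [simp]: "finite R" using finite_range_elementary[OF g] by (simp add: R_def)
  have L: "L a \<in> sets m" "emeasure m (L a) = ennreal (measure m (L a))" if "a \<in> R" for a
    using level_cell[OF g B, of a] that measurable_sets_S
    by (auto simp: L_def R_def emeasure_eq_ennreal_measure)
  have "norm (\<Sum>a\<in>R. of_real (measure m (L a)) * \<K> (s * a)) \<le> (\<Sum>a\<in>R. norm (\<K> (s * a)) * measure m (L a))"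
    by (rule order_trans[OF norm_sum]) (simp add: norm_mult mult.commute)
  then have "ennreal (norm (\<Sum>a\<in>R. of_real (measure m (L a)) * \<K> (s * a))) \<le>
      (\<Sum>a\<in>R. ennreal (norm (\<K> (s * a)) * measure m (L a)))"
    by (subst sum_ennreal) (auto intro: ennreal_leI)
  also have "\<dots> = (\<Sum>a\<in>R. \<integral>\<^sup>+x. ennreal (norm (\<K> (s * a))) * indicator (L a) x \<partial>m)"
    using L by (intro sum.cong refl) (simp add: nn_integral_cmult_indicator ennreal_mult)
  also have "\<dots> = (\<integral>\<^sup>+x. (\<Sum>a\<in>R. ennreal (norm (\<K> (s * a))) * indicator (L a) x) \<partial>m)"
    using L by (intro nn_integral_sum[symmetric]) auto
  also have "\<dots> \<le> (\<integral>\<^sup>+x. ennreal (\<alpha> x * (s * g x)\<^sup>2 + \<beta> x * \<bar>s * g x\<bar>) \<partial>m)"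
  proof (rule nn_integral_mono)
    fix x assume x: "x \<in> space m"
    have "(\<Sum>a\<in>R. ennreal (norm (\<K> (s * a))) * indicator (L a) x) \<le>
        (\<Sum>a\<in>R. if a = g x then ennreal (norm (\<K> (s * g x))) else 0)"
      by (intro sum_mono) (auto simp: L_def split: split_indicator)
    also have "\<dots> \<le> ennreal (norm (\<K> (s * g x)))"
      by (simp add: sum.delta)
    also have "\<dots> \<le> ennreal (\<alpha> x * (s * g x)\<^sup>2 + \<beta> x * \<bar>s * g x\<bar>)"
      by (intro ennreal_leI bound x)
    finally show "(\<Sum>a\<in>R. ennreal (norm (\<K> (s * a))) * indicator (L a) x) \<le>
      ennreal (\<alpha> x * (s * g x)\<^sup>2 + \<beta> x * \<bar>s * g x\<bar>)" .
  qed
  finally show ?thesis by (simp add: L_def R_def)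
qed

text \<open>
  Dominated convergence applies because the growth bound is increasing in \<open>\<bar>v\<bar>\<close> and multiplying \<open>v\<close> by
  a constant \<open>k\<close> multiplies it at most by \<open>k\<^sup>2 + \<bar>k\<bar>\<close>.
\<close>

lemma step_integral_tendsto_0:
  assumes g: "\<And>j::nat. elementary (g j)" and B: "B \<in> sets m"
    and bound: "\<And>x v. x \<in> space m \<Longrightarrow> norm (\<K> v) \<le> \<alpha> x * v\<^sup>2 + \<beta> x * \<bar>v\<bar>"
    and nonneg: "\<And>x. x \<in> space m \<Longrightarrow> 0 \<le> \<alpha> x" "\<And>x. x \<in> space m \<Longrightarrow> 0 \<le> \<beta> x"
    and meas: "\<alpha> \<in> borel_measurable m" "\<beta> \<in> borel_measurable m"
    and f: "integrable m (\<lambda>x. \<alpha> x * (f x)\<^sup>2 + \<beta> x * \<bar>f x\<bar>)"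
    and dom: "\<And>j x. x \<in> space m \<Longrightarrow> \<bar>g j x\<bar> \<le> c * \<bar>f x\<bar>"
    and lim: "\<And>x. x \<in> space m \<Longrightarrow> (\<lambda>j. g j x) \<longlonglongrightarrow> 0"
    and "\<epsilon> > 0"
  shows "(\<lambda>j. prob {\<omega> \<in> space M. \<bar>step_integral B (g j) \<omega>\<bar> > \<epsilon>}) \<longlonglongrightarrow> 0"
proof (rule char_tendsto_1_imp_in_prob_0)
  fix s :: real
  define E where "E j = (\<Sum>a\<in>g j ` space m - {0}.
    of_real (measure m (B \<inter> (g j -` {a} \<inter> space m))) * \<K> (s * a))" for j
  note [measurable] = meas
  have [measurable]: "g j \<in> borel_measurable m" for j
    using g[of j] by (auto simp: elementary_def intro: borel_measurable_simple_function)
  let ?w = "\<lambda>x. ((s * c)\<^sup>2 + \<bar>s * c\<bar>) * (\<alpha> x * (f x)\<^sup>2 + \<beta> x * \<bar>f x\<bar>)"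
  have "(\<lambda>j. \<integral>\<^sup>+x. ennreal (\<alpha> x * (s * g j x)\<^sup>2 + \<beta> x * \<bar>s * g j x\<bar>) \<partial>m) \<longlonglongrightarrow> (\<integral>\<^sup>+x. 0 \<partial>m)"
  proof (rule nn_integral_dominated_convergence[where w = "\<lambda>x. ennreal (?w x)"])
    show "(\<integral>\<^sup>+x. ennreal (?w x) \<partial>m) < \<infinity>"
    proof -
      have "integrable m ?w" using f by simp
      moreover have "AE x in m. 0 \<le> ?w x"
        using nonneg by (intro AE_I2) simp
      ultimately show ?thesis
        by (simp add: nn_integral_eq_integral)
    qed
    show "AE x in m. ennreal (\<alpha> x * (s * g j x)\<^sup>2 + \<beta> x * \<bar>s * g j x\<bar>) \<le> ennreal (?w x)" for j
    proof (intro AE_I2 ennreal_leI)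
      fix x assume x: "x \<in> space m"
      have 1: "\<bar>s * g j x\<bar> \<le> \<bar>s * c\<bar> * \<bar>f x\<bar>"
      proof -
        have "\<bar>s * g j x\<bar> \<le> \<bar>s\<bar> * (c * \<bar>f x\<bar>)"
          using dom[OF x, of j] by (simp add: abs_mult mult_left_mono)
        also have "\<dots> \<le> \<bar>s\<bar> * (\<bar>c\<bar> * \<bar>f x\<bar>)"
          by (intro mult_left_mono mult_right_mono) auto
        finally show ?thesis by (simp add: abs_mult mult.assoc)
      qed
      have 2: "(s * g j x)\<^sup>2 \<le> (s * c)\<^sup>2 * (f x)\<^sup>2"
        using power_mono[OF 1, of 2] by (simp add: power_mult_distrib)
      have "\<alpha> x * (s * g j x)\<^sup>2 + \<beta> x * \<bar>s * g j x\<bar> \<le>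
          \<alpha> x * ((s * c)\<^sup>2 * (f x)\<^sup>2) + \<beta> x * (\<bar>s * c\<bar> * \<bar>f x\<bar>)"
        using 1 2 nonneg[OF x] by (intro add_mono mult_left_mono) auto
      also have "\<dots> \<le> ((s * c)\<^sup>2 + \<bar>s * c\<bar>) * (\<alpha> x * (f x)\<^sup>2) + ((s * c)\<^sup>2 + \<bar>s * c\<bar>) * (\<beta> x * \<bar>f x\<bar>)"
        using nonneg[OF x] by (simp add: algebra_simps)
      finally show "\<alpha> x * (s * g j x)\<^sup>2 + \<beta> x * \<bar>s * g j x\<bar> \<le> ?w x"
        by (simp add: algebra_simps)
    qed
    show "AE x in m. (\<lambda>j. ennreal (\<alpha> x * (s * g j x)\<^sup>2 + \<beta> x * \<bar>s * g j x\<bar>)) \<longlonglongrightarrow> 0"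
    proof (intro AE_I2)
      fix x assume x: "x \<in> space m"
      have "(\<lambda>j. \<alpha> x * (s * g j x)\<^sup>2 + \<beta> x * \<bar>s * g j x\<bar>) \<longlonglongrightarrow> \<alpha> x * (s * 0)\<^sup>2 + \<beta> x * \<bar>s * 0\<bar>"
        by (intro tendsto_intros lim x)
      then show "(\<lambda>j. ennreal (\<alpha> x * (s * g j x)\<^sup>2 + \<beta> x * \<bar>s * g j x\<bar>)) \<longlonglongrightarrow> 0"
        using tendsto_ennrealI by fastforce
    qed
  qed (use f in \<open>auto dest: borel_measurable_integrable\<close>)
  then have int: "(\<lambda>j. \<integral>\<^sup>+x. ennreal (\<alpha> x * (s * g j x)\<^sup>2 + \<beta> x * \<bar>s * g j x\<bar>) \<partial>m) \<longlonglongrightarrow> 0"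
    by simp
  have "(\<lambda>j. ennreal (norm (E j))) \<longlonglongrightarrow> 0"
    using norm_step_exponent_le[OF g B bound]
    by (intro tendsto_sandwich[OF _ _ tendsto_const int]) (auto simp: E_def)
  then have "(\<lambda>j. norm (E j)) \<longlonglongrightarrow> 0"
    by (simp add: tendsto_ennreal_iff[where x = 0 for x :: real, simplified])
  then have "E \<longlonglongrightarrow> 0"
    by (simp add: tendsto_norm_zero_iff)
  from tendsto_exp[OF this] show "(\<lambda>j. char (distr M borel (step_integral B (g j))) s) \<longlonglongrightarrow> 1"
    by (simp add: E_def char_step_integral[OF g B])
qed (use step_integral_measurable[OF g B] \<open>\<epsilon> > 0\<close> in auto)

lemma simple_rep_of_elementary:
  assumes g: "elementary g"
  obtains F where "simple_rep S F" "\<And>x. x \<in> space m \<Longrightarrow> simple_fun F x = g x"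
    "\<And>B. simple_integral \<Lambda> B F = step_integral B g"
proof
  define R where "R = g ` space m - {0}"
  have [simp]: "finite R" using finite_range_elementary[OF g] by (simp add: R_def)
  define L where "L a = g -` {a} \<inter> space m" for a
  let ?F = "map (\<lambda>a. (a, L a)) (sorted_list_of_set R)"
  have "L a \<in> S" if "a \<in> R" for a
  proof -
    have "space m \<inter> L a = L a" by (auto simp: L_def)
    then show ?thesis
      using level_cell(1)[OF g sets.top, of a] that by (simp add: L_def R_def)
  qed
  moreover have "sorted_wrt (\<lambda>a b. L a \<inter> L b = {}) (sorted_list_of_set R)"
    by (rule sorted_wrt_mono_rel[OF _ strict_sorted_list_of_set]) (auto simp: L_def)
  ultimately show "simple_rep S ?F"
    by (auto simp: simple_rep_def sorted_wrt_map)
  have sum_F: "sum_list (map h (sorted_list_of_set R)) = sum h R" for h :: "real \<Rightarrow> real"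
    by (simp add: sum_list_distinct_conv_sum_set)
  show "simple_fun ?F x = g x" if "x \<in> space m" for x
  proof -
    have "simple_fun ?F x = (\<Sum>a\<in>R. a * indicator (L a) x)"
      using sum_F[of "\<lambda>a. a * indicator (L a) x"] by (simp add: simple_fun_def comp_def)
    also have "\<dots> = (\<Sum>a\<in>R. if a = g x then g x else 0)"
      using that by (intro sum.cong refl) (auto simp: L_def split: split_indicator)
    also have "\<dots> = (if g x \<in> R then g x else 0)"
      by (simp add: sum.delta')
    also have "\<dots> = g x"
      using that by (auto simp: R_def)
    finally show ?thesis .
  qed
  show "simple_integral \<Lambda> B ?F = step_integral B g" for B
    using sum_F[of "\<lambda>a. a * \<Lambda> (B \<inter> L a) \<omega>" for \<omega>]
    by (simp add: fun_eq_iff simple_integral_def step_integral_def comp_def L_def R_def)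
qed

text \<open>
  Simple functions bounded by \<open>2 \<bar>f\<bar>\<close> and cut off to sets of finite measure converge to \<open>f\<close>, and
  the differences of any two of them are dominated by \<open>4 \<bar>f\<bar>\<close>.  If their integrals over some \<open>B\<close> were
  not Cauchy in probability, a sequence of such differences, tending to 0 pointwise, would have
  integrals that stay away from 0 in probability.
\<close>

theorem rr_integrable_if_growth_integrable:
  fixes f \<alpha> \<beta> :: "'s \<Rightarrow> real"
  assumes "sigma_finite_measure m"
    and bound: "\<And>x v. x \<in> space m \<Longrightarrow> norm (\<K> v) \<le> \<alpha> x * v\<^sup>2 + \<beta> x * \<bar>v\<bar>"
    and nonneg: "\<And>x. x \<in> space m \<Longrightarrow> 0 \<le> \<alpha> x" "\<And>x. x \<in> space m \<Longrightarrow> 0 \<le> \<beta> x"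
    and meas: "\<alpha> \<in> borel_measurable m" "\<beta> \<in> borel_measurable m"
    and f: "f \<in> borel_measurable m" "integrable m (\<lambda>x. \<alpha> x * (f x)\<^sup>2 + \<beta> x * \<bar>f x\<bar>)"
  shows "rr_integrable M m S \<Lambda> f"
proof -
  interpret m: sigma_finite_measure m by fact
  obtain C :: "nat \<Rightarrow> 's set" where C: "range C \<subseteq> sets m" "(\<Union>i. C i) = space m"
    "\<And>i. emeasure m (C i) \<noteq> \<infinity>" "incseq C"
    using m.sigma_finite_incseq by blast
  obtain A :: "nat \<Rightarrow> 's set" where A: "range A \<subseteq> S" "incseq A" "(\<Union>n. A n) = space m"
    using exhausting by blast
  define D where "D n = C n \<inter> A n" for n
  have D: "D n \<in> S" "D n \<in> sets m" "emeasure m (D n) < \<infinity>" for n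
  proof -
    show "D n \<in> S" unfolding D_def using A(1) C(1) by (intro Int_in_S) auto
    then show "D n \<in> sets m" using measurable_sets_S by auto
    have "emeasure m (D n) \<le> emeasure m (C n)"
      unfolding D_def using C(1) by (intro emeasure_mono) auto
    also have "\<dots> < \<infinity>" using C(3)[of n] by (simp add: less_top)
    finally show "emeasure m (D n) < \<infinity>" .
  qed
  have ev_D: "\<forall>\<^sub>F n in sequentially. x \<in> D n" if x: "x \<in> space m" for x
  proof -
    obtain i where "x \<in> C i" using x C(2) by auto
    moreover obtain j where "x \<in> A j" using x A(3) by auto
    ultimately have "x \<in> D n" if "n \<ge> max i j" for n
      using that incseqD[OF A(2), of j n] incseqD[OF C(4), of i n] by (auto simp: D_def)
    then show ?thesis by (rule eventually_sequentiallyI)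
  qed
  obtain F where F: "\<And>i. simple_function m (F i)" "\<And>x. x \<in> space m \<Longrightarrow> (\<lambda>i. F i x) \<longlonglongrightarrow> f x"
      "\<And>i x. x \<in> space m \<Longrightarrow> dist (F i x) 0 \<le> 2 * dist (f x) 0"
    using borel_measurable_implies_sequence_metric[OF f(1), of 0] by blast
  define g where "g n x = F n x * indicator (D n) x" for n x
  have g: "elementary (g n)" for n
    unfolding elementary_def
  proof (intro conjI bexI[of _ "D n"])
    show "simple_function m (g n)"
      unfolding g_def using F(1) D(2) by (intro simple_function_mult) auto
  qed (use D in \<open>auto simp: g_def\<close>)
  have g_lim: "(\<lambda>n. g n x) \<longlonglongrightarrow> f x" if "x \<in> space m" for x
    using F(2)[OF that] by (rule Lim_transform_eventually)
      (use ev_D[OF that] in \<open>eventually_elim, auto simp: g_def\<close>)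
  have g_le: "\<bar>g n x\<bar> \<le> 2 * \<bar>f x\<bar>" if "x \<in> space m" for n x
    using F(3)[OF that, of n] by (auto simp: g_def split: split_indicator)
  have "\<forall>n. \<exists>R. simple_rep S R \<and> (\<forall>x\<in>space m. simple_fun R x = g n x) \<and>
      (\<forall>B. simple_integral \<Lambda> B R = step_integral B (g n))"
    using simple_rep_of_elementary[OF g] by metis
  then obtain R where R: "\<And>n. simple_rep S (R n)" "\<And>n x. x \<in> space m \<Longrightarrow> simple_fun (R n) x = g n x"
      "\<And>n B. simple_integral \<Lambda> B (R n) = step_integral B (g n)"
    by metis
  have conv: "\<exists>Y\<in>borel_measurable M. converges_in_prob M (\<lambda>n. step_integral B (g n)) Y"
    if B: "B \<in> sets m" for B
  proof (rule Cauchy_in_prob_imp_converges_in_prob)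
    show "step_integral B (g n) \<in> borel_measurable M" for n
      using g B by (rule step_integral_measurable)
    note [measurable] = this
    fix \<epsilon> \<delta> :: real assume "\<epsilon> > 0" "\<delta> > 0"
    show "\<exists>N. \<forall>n\<ge>N. \<forall>k\<ge>N. prob {\<omega> \<in> space M. \<bar>step_integral B (g n) \<omega> - step_integral B (g k) \<omega>\<bar> > \<epsilon>} < \<delta>"
    proof (rule ccontr)
      assume "\<not> ?thesis"
      then have "\<forall>N. \<exists>n k. n \<ge> N \<and> k \<ge> N \<and>
          prob {\<omega> \<in> space M. \<bar>step_integral B (g n) \<omega> - step_integral B (g k) \<omega>\<bar> > \<epsilon>} \<ge> \<delta>"
        by (metis not_less)
      then obtain n k where nk: "\<And>N. n N \<ge> N" "\<And>N. k N \<ge> N"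
        "\<And>N. prob {\<omega> \<in> space M. \<bar>step_integral B (g (n N)) \<omega> - step_integral B (g (k N)) \<omega>\<bar> > \<epsilon>} \<ge> \<delta>"
        by metis
      have n_top: "filterlim n at_top sequentially" and k_top: "filterlim k at_top sequentially"
        using nk(1,2) by (auto intro: filterlim_at_top_mono[OF filterlim_ident])
      define h where "h N x = g (n N) x - g (k N) x" for N x
      have h: "elementary (h N)" for N
        unfolding h_def using g g by (rule elementary_diff)
      have [measurable]: "step_integral B (h N) \<in> borel_measurable M" for N
        using h B by (rule step_integral_measurable)
      have "(\<lambda>N. prob {\<omega> \<in> space M. \<bar>step_integral B (h N) \<omega>\<bar> > \<epsilon>}) \<longlonglongrightarrow> 0"
      proof (rule step_integral_tendsto_0[OF h B bound nonneg meas f(2) _ _ \<open>\<epsilon> > 0\<close>])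
        fix x assume x: "x \<in> space m"
        show "\<bar>h N x\<bar> \<le> 4 * \<bar>f x\<bar>" for N
          using g_le[OF x, of "n N"] g_le[OF x, of "k N"] by (simp add: h_def)
        have "(\<lambda>N. g (n N) x - g (k N) x) \<longlonglongrightarrow> f x - f x"
          by (intro tendsto_diff filterlim_compose[OF g_lim[OF x]] n_top k_top)
        then show "(\<lambda>N. h N x) \<longlonglongrightarrow> 0" by (simp add: h_def)
      qed
      moreover have "prob {\<omega> \<in> space M. \<bar>step_integral B (h N) \<omega>\<bar> > \<epsilon>} \<ge> \<delta>" for N
      proof -
        have "prob {\<omega> \<in> space M. \<bar>step_integral B (h N) \<omega>\<bar> > \<epsilon>} =
            prob {\<omega> \<in> space M. \<bar>step_integral B (g (n N)) \<omega> - step_integral B (g (k N)) \<omega>\<bar> > \<epsilon>}"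
        proof (rule finite_measure_eq_AE)
          show "AE \<omega> in M. \<omega> \<in> {\<omega> \<in> space M. \<bar>step_integral B (h N) \<omega>\<bar> > \<epsilon>} \<longleftrightarrow>
            \<omega> \<in> {\<omega> \<in> space M. \<bar>step_integral B (g (n N)) \<omega> - step_integral B (g (k N)) \<omega>\<bar> > \<epsilon>}"
            using step_integral_diff[OF g g B, of "n N" "k N"]
            unfolding h_def[abs_def] by eventually_elim simp
        qed measurable
        then show ?thesis using nk(3)[of N] by simp
      qed
      ultimately have "\<delta> \<le> 0"
        by (intro LIMSEQ_le_const) auto
      then show False using \<open>\<delta> > 0\<close> by simp
    qed
  qed
  show ?thesis
    unfolding rr_integrable_def
  proof (intro exI[of _ R] conjI allI ballI)
    show "AE x in m. (\<lambda>n. simple_fun (R n) x) \<longlonglongrightarrow> f x"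
      using g_lim by (intro AE_I2) (simp add: R(2))
  qed (use R conv in \<open>auto simp: generates\<close>)
qed

end

section \<open>Growth of the Levy exponent\<close>

text \<open>
  The logarithm is at least 1 beyond \<open>e\<close>, while the jumps of size between 1 and \<open>e\<close> have finite total
  mass.
\<close>

lemma levy_measure_first_moment:
  assumes "levy_measure W"
    and fin: "(\<integral>\<^sup>+ x \<in> {x. 1 \<le> \<bar>x\<bar>}. ennreal (\<bar>x\<bar> * (ln \<bar>x\<bar>) ^ p) \<partial>W) < \<infinity>"
  shows "integrable W (\<lambda>x. indicator {x. 1 < \<bar>x\<bar>} x * \<bar>x\<bar> :: real)"
proof (rule integrableI_bounded)
  have [measurable_cong]: "sets W = sets borel"
    and W: "(\<integral>\<^sup>+ x. ennreal (min 1 (x\<^sup>2)) \<partial>W) < \<infinity>"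
    using assms(1) by (auto simp: levy_measure_def)
  show "(\<lambda>x. indicator {x. 1 < \<bar>x\<bar>} x * \<bar>x\<bar> :: real) \<in> borel_measurable W"
    by measurable
  have "(\<integral>\<^sup>+x. ennreal (norm (indicator {x. 1 < \<bar>x\<bar>} x * \<bar>x\<bar> :: real)) \<partial>W) \<le>
      (\<integral>\<^sup>+x. ennreal (exp 1) * ennreal (min 1 (x\<^sup>2)) +
        ennreal (\<bar>x\<bar> * (ln \<bar>x\<bar>) ^ p) * indicator {x. 1 \<le> \<bar>x\<bar>} x \<partial>W)"
  proof (rule nn_integral_mono)
    fix x :: real
    consider "\<bar>x\<bar> \<le> 1" | "1 < \<bar>x\<bar>" "\<bar>x\<bar> \<le> exp 1" | "1 < \<bar>x\<bar>" "exp 1 < \<bar>x\<bar>" by linarith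
    then show "ennreal (norm (indicator {x. 1 < \<bar>x\<bar>} x * \<bar>x\<bar> :: real)) \<le>
      ennreal (exp 1) * ennreal (min 1 (x\<^sup>2)) + ennreal (\<bar>x\<bar> * (ln \<bar>x\<bar>) ^ p) * indicator {x. 1 \<le> \<bar>x\<bar>} x"
    proof cases
      case 2
      then have "1 \<le> x\<^sup>2" using one_le_power[of "\<bar>x\<bar>" 2] by simp
      then have "ennreal \<bar>x\<bar> \<le> ennreal (exp 1) * ennreal (min 1 (x\<^sup>2))"
        using 2 by (simp add: ennreal_leI)
      then have "ennreal \<bar>x\<bar> + 0 \<le> ennreal (exp 1) * ennreal (min 1 (x\<^sup>2)) +
          ennreal (\<bar>x\<bar> * (ln \<bar>x\<bar>) ^ p) * indicator {x. 1 \<le> \<bar>x\<bar>} x"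
        by (rule add_mono) simp
      then show ?thesis using 2 by simp
    next
      case 3
      then have "1 \<le> ln \<bar>x\<bar>" by (simp add: ln_ge_iff)
      then have "1 \<le> (ln \<bar>x\<bar>) ^ p" by (rule one_le_power)
      then have "\<bar>x\<bar> * 1 \<le> \<bar>x\<bar> * (ln \<bar>x\<bar>) ^ p" by (rule mult_left_mono) simp
      then have "ennreal \<bar>x\<bar> \<le> ennreal (\<bar>x\<bar> * (ln \<bar>x\<bar>) ^ p)" by (simp add: ennreal_leI)
      then have "0 + ennreal \<bar>x\<bar> \<le> ennreal (exp 1) * ennreal (min 1 (x\<^sup>2)) +
          ennreal (\<bar>x\<bar> * (ln \<bar>x\<bar>) ^ p) * indicator {x. 1 \<le> \<bar>x\<bar>} x"
        using 3 by (intro add_mono) simp_all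
      then show ?thesis using 3 by simp
    qed simp
  qed
  also have "\<dots> < \<infinity>"
    using W fin by (simp add: nn_integral_add nn_integral_cmult ennreal_mult_less_top)
  finally show "(\<integral>\<^sup>+x. ennreal (norm (indicator {x. 1 < \<bar>x\<bar>} x * \<bar>x\<bar> :: real)) \<partial>W) < \<infinity>" .
qed

definition small_jump_moment :: "real measure \<Rightarrow> real \<Rightarrow> real" where
  "small_jump_moment W r = (\<integral>x. indicator {x. \<bar>x\<bar> \<le> r} x * x\<^sup>2 \<partial>W)"

definition medium_jump_moment :: "real measure \<Rightarrow> real \<Rightarrow> real" where
  "medium_jump_moment W r = (\<integral>x. indicator {x. r < \<bar>x\<bar> \<and> \<bar>x\<bar> \<le> 1} x * \<bar>x\<bar> \<partial>W)"

definition large_jump_moment :: "real measure \<Rightarrow> real" where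
  "large_jump_moment W = (\<integral>x. indicator {x. 1 < \<bar>x\<bar>} x * \<bar>x\<bar> \<partial>W)"

lemma jump_moments_nonneg: "0 \<le> small_jump_moment W r" "0 \<le> medium_jump_moment W r" "0 \<le> large_jump_moment W"
  by (auto simp: small_jump_moment_def medium_jump_moment_def large_jump_moment_def)

lemma levy_measure_integrable:
  assumes "levy_measure W"
  shows "integrable W (\<lambda>x. min 1 (x\<^sup>2))"
proof -
  have [measurable_cong]: "sets W = sets borel"
    using assms by (auto simp: levy_measure_def)
  show ?thesis
    using assms by (intro integrableI_bounded) (auto simp: levy_measure_def)
qed

lemma integrable_small_jump_moment:
  assumes "levy_measure W" "r \<le> 1"
  shows "integrable W (\<lambda>x. indicator {x. \<bar>x\<bar> \<le> r} x * x\<^sup>2 :: real)"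
proof (rule Bochner_Integration.integrable_bound[OF levy_measure_integrable[OF assms(1)]])
  have [measurable_cong]: "sets W = sets borel"
    using assms by (auto simp: levy_measure_def)
  show "(\<lambda>x. indicator {x. \<bar>x\<bar> \<le> r} x * x\<^sup>2 :: real) \<in> borel_measurable W"
    by measurable
  have "x\<^sup>2 \<le> 1" if "\<bar>x\<bar> \<le> r" for x :: real
    using that assms(2) by (simp add: abs_square_le_1)
  then show "AE x in W. norm (indicator {x. \<bar>x\<bar> \<le> r} x * x\<^sup>2 :: real) \<le> norm (min 1 (x\<^sup>2))"
    by (intro AE_I2) (auto split: split_indicator)
qed

lemma integrable_medium_jump_moment:
  assumes "levy_measure W" "0 < r"
  shows "integrable W (\<lambda>x. indicator {x. r < \<bar>x\<bar> \<and> \<bar>x\<bar> \<le> 1} x * \<bar>x\<bar> :: real)"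
proof (rule Bochner_Integration.integrable_bound)
  show "integrable W (\<lambda>x. (1 / r) * min 1 (x\<^sup>2))"
    using levy_measure_integrable[OF assms(1)] by simp
  have [measurable_cong]: "sets W = sets borel"
    using assms by (auto simp: levy_measure_def)
  show "(\<lambda>x. indicator {x. r < \<bar>x\<bar> \<and> \<bar>x\<bar> \<le> 1} x * \<bar>x\<bar> :: real) \<in> borel_measurable W"
    by measurable
  have "\<bar>x\<bar> \<le> (1 / r) * min 1 (x\<^sup>2)" if "r < \<bar>x\<bar>" "\<bar>x\<bar> \<le> 1" for x :: real
  proof -
    have "x\<^sup>2 \<le> 1" using that(2) by (simp add: abs_square_le_1)
    moreover have "r * \<bar>x\<bar> \<le> \<bar>x\<bar> * \<bar>x\<bar>"
      using that by (intro mult_right_mono) auto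
    then have "r * \<bar>x\<bar> \<le> x\<^sup>2"
      by (simp add: power2_eq_square)
    ultimately show ?thesis
      using assms(2) by (simp add: field_simps min_def)
  qed
  then show "AE x in W. norm (indicator {x. r < \<bar>x\<bar> \<and> \<bar>x\<bar> \<le> 1} x * \<bar>x\<bar> :: real) \<le>
    norm ((1 / r) * min 1 (x\<^sup>2))"
    using assms(2) by (intro AE_I2) (auto split: split_indicator)
qed

lemma small_jump_moment_mono:
  assumes "levy_measure W" "r \<le> r'" "r' \<le> 1"
  shows "small_jump_moment W r \<le> small_jump_moment W r'"
  unfolding small_jump_moment_def using assms
  by (intro integral_mono integrable_small_jump_moment) (auto split: split_indicator)

lemma medium_jump_moment_antimono:
  assumes "levy_measure W" "0 < r" "r \<le> r'"
  shows "medium_jump_moment W r' \<le> medium_jump_moment W r"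
  unfolding medium_jump_moment_def using assms
  by (intro integral_mono integrable_medium_jump_moment) (auto split: split_indicator)

lemma medium_jump_moment_1: "medium_jump_moment W 1 = 0"
proof -
  have "{x::real. 1 < \<bar>x\<bar> \<and> \<bar>x\<bar> \<le> 1} = {}" by auto
  then show ?thesis by (simp add: medium_jump_moment_def)
qed

text \<open>
  Taylor's second-order bound \<open>y\<^sup>2 / 2\<close> for \<open>\<bar>exp (iy) - 1 - iy\<bar>\<close> serves the jumps up to \<open>r\<close>, and the
  linear bound \<open>2 \<bar>y\<bar>\<close> those between \<open>r\<close> and 1.  Beyond 1 the compensator has size \<open>\<bar>s\<bar> \<le> \<bar>s x\<bar>\<close>
  and is estimated separately.
\<close>

lemma norm_levy_integrand_le:
  assumes "0 < r" "r \<le> 1"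
  shows "norm (iexp (s * x) - 1 - \<i> * complex_of_real (s * trunc x)) \<le>
    (s\<^sup>2 / 2) * (indicator {x. \<bar>x\<bar> \<le> r} x * x\<^sup>2) +
    2 * \<bar>s\<bar> * (indicator {x. r < \<bar>x\<bar> \<and> \<bar>x\<bar> \<le> 1} x * \<bar>x\<bar> + indicator {x. 1 < \<bar>x\<bar>} x * \<bar>x\<bar>)"
proof -
  consider "\<bar>x\<bar> \<le> r" "\<bar>x\<bar> \<le> 1" | "r < \<bar>x\<bar>" "\<bar>x\<bar> \<le> 1" | "1 < \<bar>x\<bar>" "r < \<bar>x\<bar>"
    using assms(2) by linarith
  then show ?thesis
  proof cases
    case 1
    then show ?thesis
      using iexp_approx1[of "s * x" 1]
      by (simp add: trunc_def atMost_Suc power_mult_distrib algebra_simps power2_eq_square)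
  next
    case 2
    then show ?thesis
      using iexp_approx2[of "s * x" 1]
      by (simp add: trunc_def atMost_Suc abs_mult algebra_simps)
  next
    case 3
    have "norm (iexp (s * x) - 1 - \<i> * complex_of_real (s * trunc x)) \<le>
        norm (iexp (s * x) - 1) + norm (\<i> * complex_of_real (s * trunc x))"
      by (rule norm_triangle_ineq4)
    also have "norm (iexp (s * x) - 1) \<le> \<bar>s\<bar> * \<bar>x\<bar>"
      using iexp_approx1[of "s * x" 0] by (simp add: abs_mult)
    also have "norm (\<i> * complex_of_real (s * trunc x)) = \<bar>s\<bar>"
      using 3 by (auto simp: trunc_def norm_mult abs_mult sgn_if)
    also have "\<bar>s\<bar> * \<bar>x\<bar> + \<bar>s\<bar> \<le> 2 * \<bar>s\<bar> * \<bar>x\<bar>"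
      using mult_left_mono[of 1 "\<bar>x\<bar>" "\<bar>s\<bar>"] 3 by simp
    finally show ?thesis using 3 by simp
  qed
qed

lemma norm_levy_exponent_le:
  assumes W: "levy_measure W" and large: "integrable W (\<lambda>x. indicator {x. 1 < \<bar>x\<bar>} x * \<bar>x\<bar> :: real)"
    and "0 \<le> b" "0 < r" "r \<le> 1"
  shows "norm (levy_exponent b W s) \<le>
    ((b + small_jump_moment W r) / 2) * s\<^sup>2 + (2 * (medium_jump_moment W r + large_jump_moment W)) * \<bar>s\<bar>"
proof -
  let ?f = "\<lambda>x. iexp (s * x) - 1 - \<i> * complex_of_real (s * trunc x)"
  let ?g = "\<lambda>x. (s\<^sup>2 / 2) * (indicator {x. \<bar>x\<bar> \<le> r} x * x\<^sup>2) +
    2 * \<bar>s\<bar> * (indicator {x. r < \<bar>x\<bar> \<and> \<bar>x\<bar> \<le> 1} x * \<bar>x\<bar> + indicator {x. 1 < \<bar>x\<bar>} x * \<bar>x\<bar>)"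
  note ints = integrable_small_jump_moment[OF W \<open>r \<le> 1\<close>] integrable_medium_jump_moment[OF W \<open>0 < r\<close>] large
  have g: "integrable W ?g"
    by (intro Bochner_Integration.integrable_add integrable_mult_right ints)
  have "norm (integral\<^sup>L W ?f) \<le> integral\<^sup>L W ?g"
  proof (cases "integrable W ?f")
    case True
    then show ?thesis
      using g by (rule Bochner_Integration.integral_norm_bound_integral) (rule norm_levy_integrand_le[OF assms(4,5)])
  next
    case False
    \<comment> \<open>The integral of a non-integrable function is 0 by convention.\<close>
    then show ?thesis
      by (simp add: not_integrable_integral_eq)
  qed
  also have "integral\<^sup>L W ?g = (s\<^sup>2 / 2) * small_jump_moment W r + 2 * \<bar>s\<bar> * (medium_jump_moment W r + large_jump_moment W)"
    using ints by (simp add: small_jump_moment_def medium_jump_moment_def large_jump_moment_def)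
  finally have 1: "norm (integral\<^sup>L W ?f) \<le> (s\<^sup>2 / 2) * small_jump_moment W r + 2 * \<bar>s\<bar> * (medium_jump_moment W r + large_jump_moment W)" .
  have "norm (levy_exponent b W s) \<le> norm (- complex_of_real (b / 2 * s\<^sup>2)) + norm (integral\<^sup>L W ?f)"
    unfolding levy_exponent_def by (rule norm_triangle_ineq)
  also have "norm (- complex_of_real (b / 2 * s\<^sup>2)) = b / 2 * s\<^sup>2"
    using \<open>0 \<le> b\<close> by (simp only: norm_minus_cancel norm_of_real) simp
  finally show ?thesis
    using 1 by (simp add: algebra_simps add_divide_distrib)
qed

section \<open>The exponential kernel\<close>

lemma exp_ge_power_over_fact:
  fixes y :: real
  assumes "0 \<le> y"
  shows "y ^ k / fact k \<le> exp y"
proof -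
  have s: "(\<lambda>n. y ^ n /\<^sub>R fact n) sums exp y" by (rule exp_converges)
  have "(\<Sum>n\<in>{k}. y ^ n /\<^sub>R fact n) \<le> (\<Sum>n. y ^ n /\<^sub>R fact n)"
    using assms by (intro sum_le_suminf sums_summable[OF s]) auto
  then show ?thesis
    using sums_unique[OF s] by (simp add: divide_inverse mult.commute)
qed

text \<open>
  On the shell where \<open>l \<bar>t - u\<bar>\<close> lies between \<open>n\<close> and \<open>n + 1\<close> the integrand is at most \<open>exp (-n)\<close>, and
  the shell is part of a ball of radius \<open>(n + 1) / l\<close>, whose volume scales like \<open>l\<^sup>-\<^sup>d\<close>.
\<close>

lemma nn_integral_exp_norm_le:
  "\<exists>C\<ge>0. \<forall>l>0. \<forall>t::'a::euclidean_space.
     (\<integral>\<^sup>+u. ennreal (exp (- l * norm (t - u))) \<partial>lborel) \<le> ennreal (C / l ^ DIM('a))"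
proof -
  define V where "V = unit_ball_vol (real DIM('a))"
  have "V \<ge> 0" by (simp add: V_def unit_ball_vol_nonneg)
  define c where "c n = exp (- real n) * (V * real (Suc n) ^ DIM('a))" for n
  have c_nonneg: "0 \<le> c n" for n
    using \<open>V \<ge> 0\<close> by (simp add: c_def)
  have "summable c"
  proof (rule summable_comparison_test')
    show "summable (\<lambda>n. (exp 1 * V * fact (DIM('a) + 2)) * (1 / real (Suc n) ^ 2))"
      using inverse_power_summable[of 2, where 'a = real] summable_Suc_iff[of "\<lambda>n. inverse (real n ^ 2)"]
      by (intro summable_mult) (simp add: divide_inverse)
    fix n :: nat
    \<comment> \<open>The exponent \<open>d + 2\<close> leaves the summable factor \<open>1 / (n + 1)\<^sup>2\<close> after cancelling \<open>(n + 1)\<^sup>d\<close>.\<close>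
    define y F :: real where "y = real (Suc n)" and "F = fact (DIM('a) + 2)"
    have "y > 0" "F > 0" by (simp_all add: y_def F_def)
    have y: "exp y = exp (real n) * exp 1"
      by (simp add: y_def exp_add[symmetric])
    have "y ^ (DIM('a) + 2) / F \<le> exp y"
      unfolding F_def using \<open>y > 0\<close> by (intro exp_ge_power_over_fact) simp
    then have "y ^ DIM('a) * y ^ 2 \<le> exp (real n) * exp 1 * F"
      using \<open>F > 0\<close> unfolding y power_add by (simp add: field_simps)
    then have "exp (- real n) * y ^ DIM('a) \<le> exp 1 * F * (1 / y ^ 2)"
      using \<open>y > 0\<close> by (simp add: field_simps exp_minus)
    then have "exp (- real n) * real (Suc n) ^ DIM('a) \<le>
        exp 1 * fact (DIM('a) + 2) * (1 / real (Suc n) ^ 2)"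
      unfolding y_def F_def .
    then have "V * (exp (- real n) * real (Suc n) ^ DIM('a)) \<le>
        V * (exp 1 * fact (DIM('a) + 2) * (1 / real (Suc n) ^ 2))"
      using \<open>V \<ge> 0\<close> by (rule mult_left_mono)
    then show "norm (c n) \<le> (exp 1 * V * fact (DIM('a) + 2)) * (1 / real (Suc n) ^ 2)"
      using c_nonneg[of n] by (simp add: c_def mult_ac)
  qed
  have "(\<integral>\<^sup>+u. ennreal (exp (- l * norm (t - u))) \<partial>lborel) \<le> ennreal ((\<Sum>n. c n) / l ^ DIM('a))"
    if "l > 0" for l and t :: 'a
  proof -
    have "(\<integral>\<^sup>+u. ennreal (exp (- l * norm (t - u))) \<partial>lborel) \<le>
        (\<integral>\<^sup>+u. (\<Sum>n. ennreal (exp (- real n)) * indicator (cball t (real (Suc n) / l)) u) \<partial>lborel)"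
    proof (rule nn_integral_mono)
      fix u :: 'a
      define k where "k = nat \<lfloor>l * norm (t - u)\<rfloor>"
      have k: "real k \<le> l * norm (t - u)" "l * norm (t - u) < real (Suc k)"
        using \<open>l > 0\<close> by (auto simp: k_def) linarith
      have "u \<in> cball t (real (Suc k) / l)"
        using k(2) \<open>l > 0\<close> by (simp add: dist_norm field_simps)
      then have "ennreal (exp (- l * norm (t - u))) \<le>
          (\<Sum>n\<in>{k}. ennreal (exp (- real n)) * indicator (cball t (real (Suc n) / l)) u)"
        using k(1) by (auto intro!: ennreal_leI)
      also have "\<dots> \<le> (\<Sum>n. ennreal (exp (- real n)) * indicator (cball t (real (Suc n) / l)) u)"
        by (intro sum_le_suminf) auto
      finally show "ennreal (exp (- l * norm (t - u))) \<le>
        (\<Sum>n. ennreal (exp (- real n)) * indicator (cball t (real (Suc n) / l)) u)" .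
    qed
    also have "\<dots> = (\<Sum>n. ennreal (exp (- real n)) * emeasure lborel (cball t (real (Suc n) / l)))"
    proof (subst nn_integral_suminf)
      show "(\<lambda>u. ennreal (exp (- real n)) * indicator (cball t (real (Suc n) / l)) u) \<in> borel_measurable lborel" for n
        by (intro borel_measurable_times_ennreal borel_measurable_indicator borel_measurable_const) simp
    qed (simp add: nn_integral_cmult_indicator)
    also have "\<dots> = (\<Sum>n. ennreal (c n / l ^ DIM('a)))"
      using \<open>l > 0\<close> \<open>V \<ge> 0\<close>
      by (intro suminf_cong)
        (simp add: emeasure_cball c_def V_def ennreal_mult'[symmetric] power_divide del: of_nat_Suc)
    also have "\<dots> = ennreal ((\<Sum>n. c n) / l ^ DIM('a))"
      using \<open>l > 0\<close> c_nonneg \<open>summable c\<close>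
      by (subst suminf_ennreal2) (auto simp: suminf_divide summable_divide)
    finally show ?thesis .
  qed
  then show ?thesis
    using suminf_nonneg[OF \<open>summable c\<close> c_nonneg] by blast
qed

lemma integrable_pair_exp_norm:
  fixes t :: "'a::euclidean_space"
  assumes sets: "sets \<pi> = sets (restrict_space borel {0<..})"
    and \<phi>: "\<phi> \<in> borel_measurable \<pi>" "\<And>l. l > 0 \<Longrightarrow> 0 \<le> \<phi> l"
    and int: "integrable \<pi> (\<lambda>l. \<phi> l / l ^ DIM('a))"
  shows "integrable (\<pi> \<Otimes>\<^sub>M lborel) (\<lambda>(l, u). \<phi> l * exp (- l * norm (t - u)))"
proof -
  have space: "space \<pi> = {0<..}"
    using sets_eq_imp_space_eq[OF sets] by (simp add: space_restrict_space)
  have [measurable]: "fst \<in> borel_measurable (\<pi> \<Otimes>\<^sub>M (lborel :: 'a measure))"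
    using measurable_fst[of \<pi> "lborel :: 'a measure"]
      measurable_cong_sets[OF refl sets, of "\<pi> \<Otimes>\<^sub>M (lborel :: 'a measure)"]
    by (simp add: measurable_restrict_space2_iff)
  note [measurable] = \<phi>(1)
  obtain C where C: "C \<ge> 0" "\<And>l. l > 0 \<Longrightarrow>
      (\<integral>\<^sup>+u. ennreal (exp (- l * norm (t - u))) \<partial>lborel) \<le> ennreal (C / l ^ DIM('a))"
    using nn_integral_exp_norm_le[where 'a = 'a] by blast
  show ?thesis
  proof (rule integrableI_bounded)
    have "(\<integral>\<^sup>+p. ennreal (norm (case p of (l, u) \<Rightarrow> \<phi> l * exp (- l * norm (t - u)))) \<partial>(\<pi> \<Otimes>\<^sub>M lborel)) =
        (\<integral>\<^sup>+l. \<integral>\<^sup>+u. ennreal (norm (\<phi> l * exp (- l * norm (t - u)))) \<partial>lborel \<partial>\<pi>)"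
      by (subst lborel.nn_integral_fst[symmetric]) (auto simp: case_prod_beta)
    also have "\<dots> \<le> (\<integral>\<^sup>+l. ennreal (C * (\<phi> l / l ^ DIM('a))) \<partial>\<pi>)"
    proof (rule nn_integral_mono)
      fix l assume "l \<in> space \<pi>"
      then have l: "l > 0" by (simp add: space)
      have "(\<integral>\<^sup>+u. ennreal (norm (\<phi> l * exp (- l * norm (t - u)))) \<partial>lborel) =
          ennreal (\<phi> l) * (\<integral>\<^sup>+u. ennreal (exp (- l * norm (t - u))) \<partial>lborel)"
        using \<phi>(2)[OF l] by (simp add: abs_mult ennreal_mult nn_integral_cmult)
      also have "\<dots> \<le> ennreal (\<phi> l) * ennreal (C / l ^ DIM('a))"
        by (intro mult_left_mono C(2) l) simp
      also have "\<dots> = ennreal (C * (\<phi> l / l ^ DIM('a)))"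
        using \<phi>(2)[OF l] C(1) l by (simp add: ennreal_mult'[symmetric] mult.commute)
      finally show "(\<integral>\<^sup>+u. ennreal (norm (\<phi> l * exp (- l * norm (t - u)))) \<partial>lborel) \<le>
        ennreal (C * (\<phi> l / l ^ DIM('a)))" .
    qed
    also have "\<dots> < \<infinity>"
    proof -
      have "integrable \<pi> (\<lambda>l. C * (\<phi> l / l ^ DIM('a)))"
        using int by (intro integrable_mult_right)
      moreover have "AE l in \<pi>. 0 \<le> C * (\<phi> l / l ^ DIM('a))"
        using C(1) \<phi>(2) by (intro AE_I2) (simp add: space)
      ultimately show ?thesis by (simp add: nn_integral_eq_integral)
    qed
    finally show "(\<integral>\<^sup>+p. ennreal (norm (case p of (l, u) \<Rightarrow> \<phi> l * exp (- l * norm (t - u)))) \<partial>(\<pi> \<Otimes>\<^sub>M lborel)) < \<infinity>" .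
  qed (simp add: case_prod_beta)
qed

text \<open>
  The kernel is \<open>exp (-l \<bar>t - u\<bar>) / (2 l)\<close> in absolute value, and the exponential, being at most 1,
  dominates its own square.  Hence a single integral over the second variable serves both the quadratic and the linear term.
\<close>

lemma supCAR_well_defined_if_growth_integrable:
  fixes S :: "(real \<times> (real ^ 'd)) set set" and a c :: "real \<Rightarrow> real"
  assumes rm: "id_random_measure M (\<pi> \<Otimes>\<^sub>M lborel) \<K> S \<Lambda>"
    and "finite_measure \<pi>" and sets: "sets \<pi> = sets (restrict_space borel {0<..})"
    and bound: "\<And>l v. l > 0 \<Longrightarrow> norm (\<K> v) \<le> a l * v\<^sup>2 + c l * \<bar>v\<bar>"
    and nonneg: "\<And>l. l > 0 \<Longrightarrow> 0 \<le> a l" "\<And>l. l > 0 \<Longrightarrow> 0 \<le> c l"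
    and meas: "a \<in> borel_measurable \<pi>" "c \<in> borel_measurable \<pi>"
    and int: "integrable \<pi> (\<lambda>l. a l / l ^ (CARD('d) + 2))" "integrable \<pi> (\<lambda>l. c l / l ^ (CARD('d) + 1))"
  shows "supCAR_well_defined M \<pi> S \<Lambda>"
  unfolding supCAR_well_defined_def
proof
  fix t :: "real ^ 'd"
  interpret id_random_measure M "\<pi> \<Otimes>\<^sub>M lborel" \<K> S \<Lambda> by fact
  interpret \<pi>: finite_measure \<pi> by fact
  let ?m = "\<pi> \<Otimes>\<^sub>M (lborel :: (real ^ 'd) measure)"
  note [measurable] = meas
  have space: "space \<pi> = {0<..}"
    using sets_eq_imp_space_eq[OF sets] by (simp add: space_restrict_space)
  have pos: "fst p > 0" if "p \<in> space ?m" for p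
    using that by (auto simp: space_pair_measure space)
  have id [measurable]: "(\<lambda>l. l) \<in> borel_measurable \<pi>"
    unfolding measurable_cong_sets[OF sets refl] by (intro measurable_restrict_space1) simp
  have [measurable]: "fst \<in> borel_measurable ?m"
    using measurable_compose[OF measurable_fst id] by (simp add: fun_eq_iff)
  have kernel [measurable]: "supCAR_kernel t \<in> borel_measurable ?m"
    unfolding supCAR_kernel_def case_prod_beta by measurable
  have int_a: "integrable ?m (\<lambda>(l, u). (a l / (4 * l\<^sup>2)) * exp (- l * norm (t - u)))"
  proof (rule integrable_pair_exp_norm[OF sets])
    have "integrable \<pi> (\<lambda>l. (a l / l ^ (CARD('d) + 2)) / 4)"
      by (intro integrable_divide int(1))
    then show "integrable \<pi> (\<lambda>l. a l / (4 * l\<^sup>2) / l ^ DIM(real ^ 'd))"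
      by (simp add: power2_eq_square mult_ac)
  qed (use nonneg(1) in simp_all)
  have int_c: "integrable ?m (\<lambda>(l, u). (c l / (2 * l)) * exp (- l * norm (t - u)))"
  proof (rule integrable_pair_exp_norm[OF sets])
    have "integrable \<pi> (\<lambda>l. (c l / l ^ (CARD('d) + 1)) / 2)"
      by (intro integrable_divide int(2))
    then show "integrable \<pi> (\<lambda>l. c l / (2 * l) / l ^ DIM(real ^ 'd))"
      by (simp add: power_add mult_ac)
  qed (use nonneg(2) in simp_all)
  show "rr_integrable M ?m S \<Lambda> (supCAR_kernel t)"
  proof (rule rr_integrable_if_growth_integrable[where \<alpha> = "\<lambda>p. a (fst p)" and \<beta> = "\<lambda>p. c (fst p)"])
    show "sigma_finite_measure ?m"
      by (intro sigma_finite_pair_measure \<pi>.sigma_finite_measure_axioms lborel.sigma_finite_measure_axioms)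
    show "integrable ?m (\<lambda>p. a (fst p) * (supCAR_kernel t p)\<^sup>2 + c (fst p) * \<bar>supCAR_kernel t p\<bar>)"
    proof (rule Bochner_Integration.integrable_bound[OF Bochner_Integration.integrable_add[OF int_a int_c]])
      show "AE p in ?m. norm (a (fst p) * (supCAR_kernel t p)\<^sup>2 + c (fst p) * \<bar>supCAR_kernel t p\<bar>) \<le>
        norm ((case p of (l, u) \<Rightarrow> (a l / (4 * l\<^sup>2)) * exp (- l * norm (t - u))) +
          (case p of (l, u) \<Rightarrow> (c l / (2 * l)) * exp (- l * norm (t - u))))"
      proof (intro AE_I2)
        fix p assume "p \<in> space ?m"
        obtain l u where p: "p = (l, u)" by (cases p)
        with pos[OF \<open>p \<in> space ?m\<close>] have l: "l > 0" by simp
        let ?e = "exp (- l * norm (t - u))"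
        have "?e\<^sup>2 \<le> ?e"
          using l by (simp add: power2_eq_square mult_left_le)
        then have "a l / (4 * l\<^sup>2) * ?e\<^sup>2 \<le> a l / (4 * l\<^sup>2) * ?e"
          using nonneg(1)[OF l] by (intro mult_left_mono) auto
        moreover have "a l * (supCAR_kernel t p)\<^sup>2 = a l / (4 * l\<^sup>2) * ?e\<^sup>2"
          by (simp add: p supCAR_kernel_def power_mult_distrib power_divide)
        moreover have "c l * \<bar>supCAR_kernel t p\<bar> = c l / (2 * l) * ?e"
          using l by (simp add: p supCAR_kernel_def abs_mult)
        moreover have "0 \<le> a l * (supCAR_kernel t p)\<^sup>2" "0 \<le> c l / (2 * l) * ?e"
          using nonneg[OF l] l by auto
        ultimately show "norm (a (fst p) * (supCAR_kernel t p)\<^sup>2 + c (fst p) * \<bar>supCAR_kernel t p\<bar>) \<le>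
          norm ((case p of (l, u) \<Rightarrow> (a l / (4 * l\<^sup>2)) * exp (- l * norm (t - u))) +
            (case p of (l, u) \<Rightarrow> (c l / (2 * l)) * exp (- l * norm (t - u))))"
          by (simp add: p)
      qed
    qed measurable
  qed (use bound nonneg pos in auto)
qed

section \<open>Existence of the supCAR field\<close>

text \<open>
  The function \<open>h\<close> stands for an integral over the Levy measure of which nothing is known as a
  function of \<open>l\<close>, measurability included, but that its integral is finite.  The constant \<open>c\<close> is attached to
  the measurable function \<open>\<phi>\<close> so that it can be taken out of the integral.
\<close>

lemma integrable_if_integrable_near_0:
  fixes \<phi> :: "real \<Rightarrow> real"
  assumes "finite_measure \<pi>" and space: "space \<pi> = {0<..}"
    and \<phi>: "\<phi> \<in> borel_measurable \<pi>"
    and large: "\<And>l. l > 1/2 \<Longrightarrow> \<bar>\<phi> l\<bar> \<le> K"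
    and "c > 0" and small: "\<And>l. 0 < l \<Longrightarrow> l \<le> 1/2 \<Longrightarrow> ennreal (c * \<bar>\<phi> l\<bar>) \<le> h l"
    and h: "(\<integral>\<^sup>+l\<in>{0<..1/2}. h l \<partial>\<pi>) < \<infinity>"
    and half: "{0<..1/2} \<in> sets \<pi>"
  shows "integrable \<pi> \<phi>"
proof (rule integrableI_bounded)
  interpret finite_measure \<pi> by fact
  note [measurable] = \<phi> half
  have "ennreal c * (\<integral>\<^sup>+l\<in>{0<..1/2}. ennreal \<bar>\<phi> l\<bar> \<partial>\<pi>) = (\<integral>\<^sup>+l\<in>{0<..1/2}. ennreal (c * \<bar>\<phi> l\<bar>) \<partial>\<pi>)"
    using \<open>c > 0\<close> by (subst nn_integral_cmult[symmetric]) (auto simp: ennreal_mult mult.assoc)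
  also have "\<dots> \<le> (\<integral>\<^sup>+l\<in>{0<..1/2}. h l \<partial>\<pi>)"
    using small by (intro nn_integral_mono) (auto split: split_indicator)
  finally have "ennreal c * (\<integral>\<^sup>+l\<in>{0<..1/2}. ennreal \<bar>\<phi> l\<bar> \<partial>\<pi>) < \<infinity>"
    using h by (rule order.strict_trans1)
  then have "(\<integral>\<^sup>+l\<in>{0<..1/2}. ennreal \<bar>\<phi> l\<bar> \<partial>\<pi>) < \<infinity>"
    using \<open>c > 0\<close> by (auto simp: ennreal_mult_less_top)
  moreover have "(\<integral>\<^sup>+l. ennreal K \<partial>\<pi>) < \<infinity>"
    by (simp add: emeasure_eq_measure ennreal_mult_less_top)
  moreover have "(\<integral>\<^sup>+l. ennreal (norm (\<phi> l)) \<partial>\<pi>) \<le>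
      (\<integral>\<^sup>+l. ennreal \<bar>\<phi> l\<bar> * indicator {0<..1/2} l + ennreal K \<partial>\<pi>)"
    using large space by (intro nn_integral_mono) (auto simp: not_le intro!: ennreal_leI split: split_indicator)
  ultimately show "(\<integral>\<^sup>+l. ennreal (norm (\<phi> l)) \<partial>\<pi>) < \<infinity>"
    by (subst (asm) nn_integral_add) (auto simp: le_less_trans)
qed (fact \<phi>)

lemma ln2_power_le:
  fixes l :: real
  assumes "0 < l" "l \<le> 1/2"
  shows "(ln 2) ^ p \<le> \<bar>ln l\<bar> ^ p"
proof -
  have "ln l \<le> ln (1/2)" using assms by simp
  then have "ln 2 \<le> \<bar>ln l\<bar>" by (simp add: ln_div)
  then show ?thesis by (intro power_mono) auto
qed

lemma inverse_power_le:
  fixes l :: real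
  assumes "l > 1/2"
  shows "1 / l ^ q \<le> 2 ^ q"
proof -
  have "(1/2) ^ q \<le> l ^ q" using assms by (intro power_mono) auto
  then show ?thesis using assms by (simp add: field_simps power_one_over)
qed

theorem theorem3p2:
  fixes M :: "'w measure"
    and b :: real and W \<pi> :: "real measure"
    and S :: "(real \<times> (real ^ 'd)) set set"
    and \<Lambda> :: "(real \<times> (real ^ 'd)) set \<Rightarrow> 'w \<Rightarrow> real"
  assumes "b \<ge> 0"
    and "levy_measure W"
    and "prob_space \<pi>" and "sets \<pi> = sets (restrict_space borel {0<..})"
    and "id_random_measure M (\<pi> \<Otimes>\<^sub>M lborel) (levy_exponent b W) S \<Lambda>"
    and cases:
      "(b > 0 \<and>
        (\<integral>\<^sup>+ l. ennreal (\<bar>ln l\<bar> ^ CARD('d) / l ^ (CARD('d) + 2)) \<partial>\<pi>) < \<infinity> \<and>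
        (\<integral>\<^sup>+ x \<in> {x. 1 \<le> \<bar>x\<bar>}. ennreal (\<bar>x\<bar> * (ln \<bar>x\<bar>) ^ (CARD('d) - 1)) \<partial>W) < \<infinity>)
       \<or>
       (b = 0 \<and>
        (\<integral>\<^sup>+ l. ennreal (\<bar>ln l\<bar> ^ (CARD('d) - 1) / l ^ (CARD('d) + 1)) \<partial>\<pi>) < \<infinity> \<and>
        (\<integral>\<^sup>+ x \<in> {x. 1 \<le> \<bar>x\<bar>}. ennreal (\<bar>x\<bar> * (ln \<bar>x\<bar>) ^ (CARD('d) - 1)) \<partial>W) < \<infinity> \<and>
        (\<integral>\<^sup>+ l \<in> {0<..1/2}. ennreal (\<bar>ln l\<bar> ^ (CARD('d) - 1) / l ^ (CARD('d) + 2)) *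
            (\<integral>\<^sup>+ x \<in> {-2 * l..2 * l}. ennreal (x\<^sup>2) \<partial>W) \<partial>\<pi>) < \<infinity> \<and>
        (\<forall>k \<in> {1, 2 :: nat}.
          (\<integral>\<^sup>+ l \<in> {0<..1/2}. ennreal (\<bar>ln l\<bar> ^ CARD('d) / l ^ (CARD('d) + 2 - k)) *
            (\<integral>\<^sup>+ x \<in> {x. 2 * l \<le> \<bar>x\<bar> \<and> \<bar>x\<bar> \<le> 1}. ennreal (\<bar>x\<bar> ^ (2 - k)) \<partial>W) \<partial>\<pi>) < \<infinity>))"
  shows "supCAR_well_defined M \<pi> S \<Lambda>"
proof -
  note W = \<open>levy_measure W\<close> and sets = \<open>sets \<pi> = sets (restrict_space borel {0<..})\<close>
  interpret \<pi>: prob_space \<pi> by fact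
  have space: "space \<pi> = {0<..}"
    using sets_eq_imp_space_eq[OF sets] by (simp add: space_restrict_space)
  have id [measurable]: "(\<lambda>l. l) \<in> borel_measurable \<pi>"
    unfolding measurable_cong_sets[OF sets refl] by (intro measurable_restrict_space1) simp
  have half: "{0<..1/2} \<in> sets \<pi>"
    unfolding sets by (subst sets_restrict_space_iff) auto
  have fin: "finite_measure \<pi>" by unfold_locales
  note near_0 = integrable_if_integrable_near_0[OF fin space, where c = "(ln 2) ^ p" for p, OF _ _ _ _ _ half]
  have set_nn: "(\<integral>\<^sup>+ l \<in> {0<..1/2}. h l \<partial>\<pi>) < \<infinity>" if "(\<integral>\<^sup>+ l. h l \<partial>\<pi>) < \<infinity>" for h :: "real \<Rightarrow> ennreal"
    using that by (rule order.strict_trans1[rotated]) (intro nn_integral_mono, auto split: split_indicator)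
  have large: "integrable W (\<lambda>x. indicator {x. 1 < \<bar>x\<bar>} x * \<bar>x\<bar> :: real)"
    using cases by (auto intro: levy_measure_first_moment[OF W])
  note growth = norm_levy_exponent_le[OF W large \<open>b \<ge> 0\<close>]
  note well_defined = supCAR_well_defined_if_growth_integrable[OF
      \<open>id_random_measure M (\<pi> \<Otimes>\<^sub>M lborel) (levy_exponent b W) S \<Lambda>\<close> fin sets]
  have inverse_power: "integrable \<pi> (\<lambda>l. 1 / l ^ q)"
    if "(\<integral>\<^sup>+ l. ennreal (\<bar>ln l\<bar> ^ p / l ^ q') \<partial>\<pi>) < \<infinity>" "q \<le> q'" for p q q'
  proof (rule near_0[OF _ _ _ _ set_nn[OF that(1)]])
    fix l :: real assume l: "0 < l" "l \<le> 1/2"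
    have "l ^ q' \<le> l ^ q" using l that(2) by (intro power_decreasing) auto
    then have "(ln 2) ^ p * (1 / l ^ q) \<le> \<bar>ln l\<bar> ^ p * (1 / l ^ q')"
      using l by (intro mult_mono ln2_power_le divide_left_mono) auto
    then show "ennreal ((ln 2) ^ p * \<bar>1 / l ^ q\<bar>) \<le> ennreal (\<bar>ln l\<bar> ^ p / l ^ q')"
      using l by (intro ennreal_leI) simp
  next
    show "\<bar>1 / l ^ q\<bar> \<le> 2 ^ q" if "l > 1/2" for l :: real
      using inverse_power_le[OF that, of q] that by simp
  qed simp_all
  show ?thesis
    using cases
  proof (elim disjE conjE)
    assume hyp: "(\<integral>\<^sup>+ l. ennreal (\<bar>ln l\<bar> ^ CARD('d) / l ^ (CARD('d) + 2)) \<partial>\<pi>) < \<infinity>"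
    show ?thesis
    proof (rule well_defined)
      show "norm (levy_exponent b W v) \<le>
          ((b + small_jump_moment W 1) / 2) * v\<^sup>2 + (2 * (medium_jump_moment W 1 + large_jump_moment W)) * \<bar>v\<bar>" for v
        by (rule growth) auto
      show "integrable \<pi> (\<lambda>l. (b + small_jump_moment W 1) / 2 / l ^ (CARD('d) + 2))"
        using integrable_mult_right[OF inverse_power[OF hyp, of "CARD('d) + 2"], of "(b + small_jump_moment W 1) / 2"]
        by simp
      show "integrable \<pi> (\<lambda>l. 2 * (medium_jump_moment W 1 + large_jump_moment W) / l ^ (CARD('d) + 1))"
        using integrable_mult_right[OF inverse_power[OF hyp, of "CARD('d) + 1"],
            of "2 * (medium_jump_moment W 1 + large_jump_moment W)"]
        by simp
    qed (use jump_moments_nonneg \<open>b \<ge> 0\<close> in auto)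
  next
    assume "b = 0"
      and hyp1: "(\<integral>\<^sup>+ l. ennreal (\<bar>ln l\<bar> ^ (CARD('d) - 1) / l ^ (CARD('d) + 1)) \<partial>\<pi>) < \<infinity>"
      and hyp2: "(\<integral>\<^sup>+ l \<in> {0<..1/2}. ennreal (\<bar>ln l\<bar> ^ (CARD('d) - 1) / l ^ (CARD('d) + 2)) *
            (\<integral>\<^sup>+ x \<in> {-2 * l..2 * l}. ennreal (x\<^sup>2) \<partial>W) \<partial>\<pi>) < \<infinity>"
      and hyp3: "\<forall>k \<in> {1, 2 :: nat}.
          (\<integral>\<^sup>+ l \<in> {0<..1/2}. ennreal (\<bar>ln l\<bar> ^ CARD('d) / l ^ (CARD('d) + 2 - k)) *
            (\<integral>\<^sup>+ x \<in> {x. 2 * l \<le> \<bar>x\<bar> \<and> \<bar>x\<bar> \<le> 1}. ennreal (\<bar>x\<bar> ^ (2 - k)) \<partial>W) \<partial>\<pi>) < \<infinity>"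
    have hyp3': "(\<integral>\<^sup>+ l \<in> {0<..1/2}. ennreal (\<bar>ln l\<bar> ^ CARD('d) / l ^ (CARD('d) + 1)) *
            (\<integral>\<^sup>+ x \<in> {x. 2 * l \<le> \<bar>x\<bar> \<and> \<bar>x\<bar> \<le> 1}. ennreal \<bar>x\<bar> \<partial>W) \<partial>\<pi>) < \<infinity>"
      using bspec[OF hyp3, of 1] by simp
    \<comment> \<open>The kernel is at most \<open>1 / (2 l)\<close> in absolute value, so \<open>2 l\<close> is where the linear bound overtakes the quadratic one in order of magnitude.\<close>
    define r :: "real \<Rightarrow> real" where "r l = min 1 (2 * l)" for l
    have r: "0 < r l" "r l \<le> 1" if "0 < l" for l
      using that by (auto simp: r_def)
    have r_small: "r l = 2 * l" if "l \<le> 1/2" for l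
      using that by (simp add: r_def)
    have r_large: "r l = 1" if "l > 1/2" for l
      using that by (simp add: r_def)
    \<comment> \<open>Monotonicity yields the measurability of the truncated moments as functions of \<open>l\<close>.\<close>
    have mono_small: "mono_on {0<..} (\<lambda>l. small_jump_moment W (r l))"
      using W by (intro mono_onI small_jump_moment_mono) (auto simp: r_def)
    then have small_meas [measurable]: "(\<lambda>l. small_jump_moment W (r l)) \<in> borel_measurable \<pi>"
      unfolding measurable_cong_sets[OF sets refl] by (rule borel_measurable_mono_on_fnc)
    have "mono_on {0<..} (\<lambda>l. - medium_jump_moment W (r l))"
      using W r by (intro mono_onI le_imp_neg_le medium_jump_moment_antimono) (auto simp: r_def)
    then have "(\<lambda>l. - (- medium_jump_moment W (r l))) \<in> borel_measurable \<pi>"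
      unfolding measurable_cong_sets[OF sets refl]
      by (intro borel_measurable_uminus borel_measurable_mono_on_fnc)
    then have medium_meas [measurable]: "(\<lambda>l. medium_jump_moment W (r l)) \<in> borel_measurable \<pi>"
      by simp
    have int_small: "integrable \<pi> (\<lambda>l. small_jump_moment W (r l) / l ^ (CARD('d) + 2))"
    proof (rule near_0[OF _ _ _ _ hyp2])
      fix l :: real assume l: "0 < l" "l \<le> 1/2"
      have "ennreal (small_jump_moment W (2 * l)) = (\<integral>\<^sup>+x. ennreal (indicator {x. \<bar>x\<bar> \<le> 2 * l} x * x\<^sup>2) \<partial>W)"
        unfolding small_jump_moment_def using W l
        by (intro nn_integral_eq_integral[symmetric] integrable_small_jump_moment) auto
      also have "\<dots> = (\<integral>\<^sup>+ x \<in> {-2 * l..2 * l}. ennreal (x\<^sup>2) \<partial>W)"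
        by (intro nn_integral_cong) (auto split: split_indicator)
      finally have eq: "(\<integral>\<^sup>+ x \<in> {-2 * l..2 * l}. ennreal (x\<^sup>2) \<partial>W) = ennreal (small_jump_moment W (2 * l))" ..
      have "(ln 2) ^ (CARD('d) - 1) * (small_jump_moment W (2 * l) / l ^ (CARD('d) + 2)) \<le>
          \<bar>ln l\<bar> ^ (CARD('d) - 1) * (small_jump_moment W (2 * l) / l ^ (CARD('d) + 2))"
        using l by (intro mult_right_mono ln2_power_le) (auto simp: jump_moments_nonneg)
      then show "ennreal ((ln 2) ^ (CARD('d) - 1) * \<bar>small_jump_moment W (r l) / l ^ (CARD('d) + 2)\<bar>) \<le>
          ennreal (\<bar>ln l\<bar> ^ (CARD('d) - 1) / l ^ (CARD('d) + 2)) *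
            (\<integral>\<^sup>+ x \<in> {-2 * l..2 * l}. ennreal (x\<^sup>2) \<partial>W)"
        unfolding eq using l
        by (simp add: r_small jump_moments_nonneg ennreal_mult'[symmetric] abs_divide ennreal_leI)
    next
      show "\<bar>small_jump_moment W (r l) / l ^ (CARD('d) + 2)\<bar> \<le> small_jump_moment W 1 * 2 ^ (CARD('d) + 2)"
        if "l > 1/2" for l :: real
        using mult_left_mono[OF inverse_power_le[OF that, of "CARD('d) + 2"] jump_moments_nonneg(1)[of W 1]] that
        by (simp add: r_large jump_moments_nonneg abs_divide)
    qed simp_all
    have int_medium: "integrable \<pi> (\<lambda>l. medium_jump_moment W (r l) / l ^ (CARD('d) + 1))"
    proof (rule near_0[OF _ _ _ _ hyp3'])
      fix l :: real assume l: "0 < l" "l \<le> 1/2"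
      have "ennreal (medium_jump_moment W (2 * l)) =
          (\<integral>\<^sup>+x. ennreal (indicator {x. 2 * l < \<bar>x\<bar> \<and> \<bar>x\<bar> \<le> 1} x * \<bar>x\<bar>) \<partial>W)"
        unfolding medium_jump_moment_def using W l
        by (intro nn_integral_eq_integral[symmetric] integrable_medium_jump_moment) auto
      also have "\<dots> \<le> (\<integral>\<^sup>+ x \<in> {x. 2 * l \<le> \<bar>x\<bar> \<and> \<bar>x\<bar> \<le> 1}. ennreal \<bar>x\<bar> \<partial>W)"
        by (intro nn_integral_mono) (auto split: split_indicator)
      finally have le: "ennreal (medium_jump_moment W (2 * l)) \<le>
          (\<integral>\<^sup>+ x \<in> {x. 2 * l \<le> \<bar>x\<bar> \<and> \<bar>x\<bar> \<le> 1}. ennreal \<bar>x\<bar> \<partial>W)" .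
      have "(ln 2) ^ CARD('d) * (medium_jump_moment W (2 * l) / l ^ (CARD('d) + 1)) \<le>
          \<bar>ln l\<bar> ^ CARD('d) * (medium_jump_moment W (2 * l) / l ^ (CARD('d) + 1))"
        using l by (intro mult_right_mono ln2_power_le) (auto simp: jump_moments_nonneg)
      then have "ennreal ((ln 2) ^ CARD('d) * \<bar>medium_jump_moment W (r l) / l ^ (CARD('d) + 1)\<bar>) \<le>
          ennreal (\<bar>ln l\<bar> ^ CARD('d) / l ^ (CARD('d) + 1)) * ennreal (medium_jump_moment W (2 * l))"
        using l by (simp add: r_small jump_moments_nonneg ennreal_mult'[symmetric] abs_divide ennreal_leI)
      also have "\<dots> \<le> ennreal (\<bar>ln l\<bar> ^ CARD('d) / l ^ (CARD('d) + 1)) *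
            (\<integral>\<^sup>+ x \<in> {x. 2 * l \<le> \<bar>x\<bar> \<and> \<bar>x\<bar> \<le> 1}. ennreal \<bar>x\<bar> \<partial>W)"
        by (intro mult_left_mono le) simp
      finally show "ennreal ((ln 2) ^ CARD('d) * \<bar>medium_jump_moment W (r l) / l ^ (CARD('d) + 1)\<bar>) \<le>
          ennreal (\<bar>ln l\<bar> ^ CARD('d) / l ^ (CARD('d) + 1)) *
            (\<integral>\<^sup>+ x \<in> {x. 2 * l \<le> \<bar>x\<bar> \<and> \<bar>x\<bar> \<le> 1}. ennreal \<bar>x\<bar> \<partial>W)" .
    next
      show "\<bar>medium_jump_moment W (r l) / l ^ (CARD('d) + 1)\<bar> \<le> 0" if "l > 1/2" for l :: real
        using that by (simp add: r_large medium_jump_moment_1)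
    qed simp_all
    show ?thesis
    proof (rule well_defined)
      show "norm (levy_exponent b W v) \<le>
          (small_jump_moment W (r l) / 2) * v\<^sup>2 + (2 * (medium_jump_moment W (r l) + large_jump_moment W)) * \<bar>v\<bar>"
        if "l > 0" for l v
        using growth[OF r[OF that], of v] \<open>b = 0\<close> by simp
      show "integrable \<pi> (\<lambda>l. small_jump_moment W (r l) / 2 / l ^ (CARD('d) + 2))"
        using integrable_mult_right[OF int_small, of "1/2"] by simp
      have "integrable \<pi> (\<lambda>l. 2 * (medium_jump_moment W (r l) / l ^ (CARD('d) + 1)) +
          (2 * large_jump_moment W) * (1 / l ^ (CARD('d) + 1)))"
        by (intro Bochner_Integration.integrable_add integrable_mult_right int_medium
            inverse_power[OF hyp1] order_refl)
      then show "integrable \<pi> (\<lambda>l. 2 * (medium_jump_moment W (r l) + large_jump_moment W) / l ^ (CARD('d) + 1))"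
        by (simp add: add_divide_distrib algebra_simps)
    qed (use jump_moments_nonneg in simp_all)
  qed
qed

end
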